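(* Let $\Gamma$ be a simple strongly connected digraph with vertex set $X$, adjacency matrix $A$, diameter $D$ and adjacency algebra $\mathcal{A}$ (the algebra generated by $A$), and let $A_0=I, A_1=A, A_2,\ldots,A_D$ be its distance-$i$ matrices. Let $d+1$ be the number of distinct eigenvalues of $A$. Then the following are equivalent. (i) $\Gamma$ is a distance-regular digraph. (ii) For every vertex $x\in X$, the partition $\{\Gamma^{\leftarrow}_0(x),\Gamma^{\leftarrow}_1(x),\ldots,\Gamma^{\leftarrow}_D(x)\}$ of $X$ is equitable and its corresponding parameters do not depend on the choice of $x$. (iii) $(X,\{R_i\}_{i=0}^D)$ is a commutative association scheme, where $R_i=\{(x,y)\in X\times X\mid (A_i)_{xy}=1\}$ $(0\le i\le D)$. (iv) $\mathcal{A}$ is the Bose--Mesner algebra of a commutative $D$-class association scheme. (v) $A^\top\in\{A_0,A_1,\ldots,A_D\}$, and there exist complex scalars $p^h_{i1}$ $(0\le i,h\le D)$ such that $A_iA=\sum_{h=0}^D p^h_{i1}A_h$ for $0\le i\le D$. (vi) $(X,\{R_{\mathbf{i}}\}_{\mathbf{i}\in\Delta})$ is a commutative $D$-class association scheme, where $\Delta=\{(\partial(x,y),\partial(y,x))\mid x,y\in X\}$ and, for $\mathbf{i}\in\Delta$, $R_{\mathbf{i}}$ is the set of ordered pairs $(x,y)\in X\times X$ with $(\partial(x,y),\partial(y,x))=\mathbf{i}$. (vii) $\Gamma$ is regular, has spectrally maximum diameter $D=d$, and the matrices $A^\top$ and $A_D$ are polynomials in $A$. (viii) $\Gamma$ is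 regular, has spectrally maximum diameter $D=d$, $A^\top$ is a polynomial in $A$, and $$\frac{1}{|X|}\sum_{x\in X}|\Gamma^{\rightarrow}_D(x)|=|X|\left(\sum_{j=0}^d\frac{|\pi_0|^2}{m(\lambda_j)|\pi_j|^2}\right)^{-1},$$ where $\lambda_0,\ldots,\lambda_d$ are the distinct eigenvalues of $\Gamma$ with multiplicities $m(\lambda_0),\ldots,m(\lambda_d)$ (with $\lambda_0$ the valency) and $\pi_i=\prod_{j=0,\,j\neq i}^d(\lambda_i-\lambda_j)$.
   Context: $\partial(x,y)$ denotes the directed distance from $x$ to $y$ (length of a shortest directed path). $\Gamma^{\rightarrow}_i(x)=\{z\in X\mid \partial(x,z)=i\}$, $\Gamma^{\leftarrow}_i(x)=\{z\in X\mid \partial(z,x)=i\}$. The distance-$i$ matrix $A_i$ has $(A_i)_{xy}=1$ if $\partial(x,y)=i$ and $0$ otherwise. A partition $\{P_0,\ldots,P_s\}$ of $X$ is equitable if for all $i,j$ the numbers $|\Gamma^{\rightarrow}_1(y)\cap P_j|$ and $|\Gamma^{\leftarrow}_1(y)\cap P_j|$ are the same for all $y\in P_i$; these numbers are its corresponding parameters. $\Gamma$ is a distance-regular digraph if for every $x\in X$ the partition $\{\Gamma^{\rightarrow}_0(x),\ldots,\Gamma^{\rightarrow}_D(x)\}$ is equitable and its corresponding parameters do not depend on $x$, i.e., there are integers $d^{\rightarrow}_{ij},d^{\leftarrow}_{ij}$ with $|\Gamma^{\rightarrow}_1(y)\cap\Gamma^{\rightarrow}_j(x)|=d^{\rightarrow}_{ij}$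 and $|\Gamma^{\leftarrow}_1(y)\cap\Gamma^{\rightarrow}_j(x)|=d^{\leftarrow}_{ij}$ for all $x\in X$, $y\in\Gamma^{\rightarrow}_i(x)$. A commutative $d$-class association scheme on $X$ is a partition $\{R_0,\ldots,R_d\}$ of $X\times X$ into nonempty relations with $0/1$ adjacency matrices $B_0,\ldots,B_d$ such that $B_0=I$, $\sum B_i=J$, each $B_i^\top\in\{B_0,\ldots,B_d\}$, each $B_iB_j$ is a linear combination of $B_0,\ldots,B_d$, and $B_iB_j=B_jB_i$; its Bose--Mesner algebra is $\mathrm{span}\{B_0,\ldots,B_d\}$. A digraph is regular (of valency $k$) if every vertex has in-degree and out-degree $k$. Spectrally maximum diameter means $D=d$ where $d+1$ is the number of distinct eigenvalues of $A$. *)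

theory Defs
  imports
    "HOL-Analysis.Analysis"
    "HOL-Library.Disjoint_Sets"
    "HOL-Computational_Algebra.Polynomial"
    "Graph_Theory.Graph_Theory"
begin

section \<open>Distances in a digraph\<close>

text \<open>
  All notions are used for a strongly connected \<^const>\<open>digraph\<close>, where a directed path exists
  between any two vertices; otherwise the \<open>LEAST\<close> below would be a junk value.
\<close>

definition ddist :: "('v, 'e) pre_digraph \<Rightarrow> 'v \<Rightarrow> 'v \<Rightarrow> nat" where
  "ddist G x y = (LEAST n. \<exists>p. pre_digraph.apath G x p y \<and> length p = n)"

definition diam :: "('v, 'e) pre_digraph \<Rightarrow> nat" where
  "diam G = Max {ddist G x y | x y. x \<in> verts G \<and> y \<in> verts G}"

definition out_sphere :: "('v, 'e) pre_digraph \<Rightarrow> nat \<Rightarrow> 'v \<Rightarrow> 'v set" where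
  "out_sphere G i x = {z \<in> verts G. ddist G x z = i}"

definition in_sphere :: "('v, 'e) pre_digraph \<Rightarrow> nat \<Rightarrow> 'v \<Rightarrow> 'v set" where
  "in_sphere G i x = {z \<in> verts G. ddist G z x = i}"

definition regular_digraph :: "('v, 'e) pre_digraph \<Rightarrow> nat \<Rightarrow> bool" where
  "regular_digraph G k \<longleftrightarrow> (\<forall>x\<in>verts G. in_degree G x = k \<and> out_degree G x = k)"

text \<open>
  The cells \<open>P 0, \<dots>, P s\<close> may be empty, because \<open>out_sphere G i x\<close> may be empty for
  \<open>i \<le> diam G\<close>.  The parameters \<open>dout i j\<close> and \<open>din i j\<close> are constrained only if \<open>P i\<close> is nonempty.
\<close>

definition equitable_with ::
  "('v, 'e) pre_digraph \<Rightarrow> nat \<Rightarrow> (nat \<Rightarrow> 'v set) \<Rightarrow> (nat \<Rightarrow> nat \<Rightarrow> nat) \<Rightarrow> (nat \<Rightarrow> nat \<Rightarrow> nat) \<Rightarrow> bool"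
where
  "equitable_with G s P dout din \<longleftrightarrow>
     disjoint_family_on P {0..s} \<and> (\<Union>i\<in>{0..s}. P i) = verts G \<and>
     (\<forall>i\<in>{0..s}. \<forall>j\<in>{0..s}. \<forall>y\<in>P i.
        card (out_sphere G 1 y \<inter> P j) = dout i j \<and>
        card (in_sphere G 1 y \<inter> P j) = din i j)"

definition distance_regular_digraph :: "('v, 'e) pre_digraph \<Rightarrow> bool" where
  "distance_regular_digraph G \<longleftrightarrow>
     (\<exists>dout din. \<forall>x\<in>verts G. equitable_with G (diam G) (\<lambda>i. out_sphere G i x) dout din)"


section \<open>Complex matrices indexed by a finite type\<close>

text \<open>
  The scalar multiplication \<open>(*s)\<close> of the library would multiply the rows of a matrix
  componentwise by another row, and \<open>(*\<^sub>R)\<close> is real, hence a separate complex scaling.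
\<close>

definition mscale :: "complex \<Rightarrow> complex^'n^'m \<Rightarrow> complex^'n^'m" where
  "mscale c M = (\<chi> i j. c * M $ i $ j)"

global_interpretation cmat: vector_space "mscale :: complex \<Rightarrow> complex^'n^'m \<Rightarrow> complex^'n^'m"
  by unfold_locales (simp_all add: mscale_def vec_eq_iff algebra_simps)

definition mpow :: "complex^'n^'n \<Rightarrow> nat \<Rightarrow> complex^'n^'n" where
  "mpow M k = (((**) M) ^^ k) (mat 1)"

definition mpoly :: "complex poly \<Rightarrow> complex^'n^'n \<Rightarrow> complex^'n^'n" where
  "mpoly p M = (\<Sum>i\<le>degree p. mscale (coeff p i) (mpow M i))"

definition polynomial_in :: "complex^'n^'n \<Rightarrow> complex^'n^'n \<Rightarrow> bool" where
  "polynomial_in B M \<longleftrightarrow> (\<exists>p. B = mpoly p M)"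

definition eigenvalues :: "complex^'n^'n \<Rightarrow> complex set" where
  "eigenvalues M = {c. \<exists>v. v \<noteq> 0 \<and> M *v v = c *s v}"

definition charpoly :: "complex^'n^'n \<Rightarrow> complex poly" where
  "charpoly M = det (mat [:0, 1:] - map_matrix (\<lambda>a. [:a:]) M)"

text \<open>
  Algebraic multiplicity.  It is used below only for normal matrices, where it is also the
  dimension of the eigenspace.
\<close>

definition eig_mult :: "complex^'n^'n \<Rightarrow> complex \<Rightarrow> nat" where
  "eig_mult M c = order c (charpoly M)"

definition eig_pi :: "complex^'n^'n \<Rightarrow> complex \<Rightarrow> complex" where
  "eig_pi M c = (\<Prod>c'\<in>eigenvalues M - {c}. c - c')"

definition adj_matrix :: "('v::finite, 'e) pre_digraph \<Rightarrow> complex^'v^'v" where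
  "adj_matrix G = (\<chi> x y. if x \<rightarrow>\<^bsub>G\<^esub> y then 1 else 0)"

definition dist_matrix :: "('v::finite, 'e) pre_digraph \<Rightarrow> nat \<Rightarrow> complex^'v^'v" where
  "dist_matrix G i = (\<chi> x y. if ddist G x y = i then 1 else 0)"

definition generated_algebra :: "complex^'n^'n \<Rightarrow> (complex^'n^'n) set" where
  "generated_algebra M =
     (\<lambda>S. cmat.subspace S \<and> mat 1 \<in> S \<and> (\<forall>B\<in>S. \<forall>C\<in>S. B ** C \<in> S)) hull {M}"


section \<open>Commutative association schemes\<close>

definition rel_matrix :: "('v::finite \<times> 'v) set \<Rightarrow> complex^'v^'v" where
  "rel_matrix R = (\<chi> x y. if (x, y) \<in> R then 1 else 0)"

text \<open>
  The vertex set is the whole type.  The relations are indexed by an arbitrary set \<open>I\<close>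
  with \<open>d + 1\<close> elements, and \<open>i0\<close> is the index of the identity relation.
\<close>

definition comm_assoc_scheme ::
  "nat \<Rightarrow> 'i set \<Rightarrow> 'i \<Rightarrow> ('i \<Rightarrow> ('v::finite \<times> 'v) set) \<Rightarrow> bool"
where
  "comm_assoc_scheme d I i0 R \<longleftrightarrow>
     finite I \<and> card I = d + 1 \<and> i0 \<in> I \<and>
     inj_on R I \<and> partition_on UNIV (R ` I) \<and>
     rel_matrix (R i0) = mat 1 \<and>
     (\<Sum>i\<in>I. rel_matrix (R i)) = (\<chi> x y. 1) \<and>
     (\<forall>i\<in>I. \<exists>j\<in>I. transpose (rel_matrix (R i)) = rel_matrix (R j)) \<and>
     (\<forall>i\<in>I. \<forall>j\<in>I. rel_matrix (R i) ** rel_matrix (R j) \<in> cmat.span ((\<lambda>h. rel_matrix (R h)) ` I)) \<and>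
     (\<forall>i\<in>I. \<forall>j\<in>I. rel_matrix (R i) ** rel_matrix (R j) = rel_matrix (R j) ** rel_matrix (R i))"

definition bose_mesner_algebra ::
  "'i set \<Rightarrow> ('i \<Rightarrow> ('v::finite \<times> 'v) set) \<Rightarrow> (complex^'v^'v) set"
where
  "bose_mesner_algebra I R = cmat.span ((\<lambda>i. rel_matrix (R i)) ` I)"

end

(*
  Call a matrix distance-invariant if its (x,y) entry depends only on the distance from x to y.
  Conditions (i)-(vi) all amount to: the powers of A and the transpose of A are distance-invariant.
  Indeed A^k vanishes at distances greater than k and is positive at distance k, so then a triangular
  elimination expresses every distance-invariant matrix as a polynomial in A.  The distance-invariant
  matrices therefore form a commutative algebra, closed under transposition because the transpose of A
  is itself a polynomial in A.

  For (vii) and (viii) one works in the algebra of real polynomials in the normal matrix A, with the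
  inner product given by the trace of X Y^*, and with U_i, the orthogonal complement of I, A, ...,
  A^(i-1).  If A_D lies in the algebra, it spans U_D.  The transpose of A maps U_(i+1) to U_i and
  lowers distances by at most one, so by descending induction every matrix in U_i is supported on
  distances at least i; projecting the all-ones matrix J then yields A_0 + ... + A_i for every i.  For (viii),
  let T be the component of J in U_D.  It equals 1 at distance D, so the inner product of A_D with T
  is the squared norm of A_D, and hence A_D = T if and only if the two have equal norms.  The norm of T is
  computed from the spectrum by testing T = p(A) against the polynomials prod_(c' <> c) (x - c'),
  which are monic of degree D.
*)
theory Submission
  imports Defs "HOL-Computational_Algebra.Fundamental_Theorem_Algebra"
begin

section \<open>Polynomials of a matrix\<close>

lemma mscale_nth [simp]: "mscale c M $ i $ j = c * M $ i $ j"
  by (simp add: mscale_def)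

lemma mscale_mult_left: "mscale c M ** N = mscale c (M ** N)"
  by (simp add: vec_eq_iff matrix_matrix_mult_def sum_distrib_left mult.assoc)

lemma mscale_mult_right: "M ** mscale c N = mscale c (M ** N)"
  by (simp add: vec_eq_iff matrix_matrix_mult_def sum_distrib_left mult.left_commute)

lemma mscale_vector: "mscale c M *v v = c *s (M *v v)"
  by (simp add: vec_eq_iff matrix_vector_mult_def sum_distrib_left mult.assoc)

lemma sum_matrix_mult: "(\<Sum>i\<in>S. f i) ** N = (\<Sum>i\<in>S. f i ** (N :: complex^'n^'n))"
  by (induction S rule: infinite_finite_induct)
    (simp_all add: vec_eq_iff matrix_matrix_mult_def sum.distrib algebra_simps)

lemma matrix_mult_sum_right: "N ** (\<Sum>i\<in>S. f i) = (\<Sum>i\<in>S. N ** (f i :: complex^'n^'n))"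
  by (induction S rule: infinite_finite_induct)
    (simp_all add: vec_eq_iff matrix_matrix_mult_def sum.distrib algebra_simps)

lemma mat_minus_mult: "(M - N) ** K = M ** K - N ** (K :: complex^'k^'n)"
  by (simp add: vec_eq_iff matrix_matrix_mult_def sum_subtractf algebra_simps)

lemma matrix_add_rdistrib: "(M + N) ** K = M ** K + N ** (K :: complex^'k^'n)"
  by (simp add: vec_eq_iff matrix_matrix_mult_def sum.distrib algebra_simps)

lemma mpow_0 [simp]: "mpow M 0 = mat 1"
  by (simp add: mpow_def)

lemma mpow_Suc: "mpow M (Suc k) = M ** mpow M k"
  by (simp add: mpow_def)

lemma mpow_add: "mpow M (a + b) = mpow M a ** mpow M b"
  by (induction a) (simp_all add: mpow_Suc matrix_mul_assoc)

lemma mpow_1 [simp]: "mpow M (Suc 0) = M"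
  by (simp add: mpow_Suc)

lemma mpow_Suc2: "mpow M (Suc k) = mpow M k ** M"
  using mpow_add[of M k 1] by simp

lemma mpoly_altdef:
  assumes "degree p \<le> n"
  shows "mpoly p M = (\<Sum>i\<le>n. mscale (coeff p i) (mpow M i))"
  unfolding mpoly_def
  by (rule sum.mono_neutral_left) (use assms in \<open>auto simp: coeff_eq_0 vec_eq_iff\<close>)

lemma mpoly_pCons: "mpoly (pCons a p) M = mscale a (mat 1) + M ** mpoly p M"
proof -
  have "mpoly (pCons a p) M = (\<Sum>i\<le>Suc (degree p). mscale (coeff (pCons a p) i) (mpow M i))"
    by (rule mpoly_altdef) (simp add: degree_pCons_le)
  also have "\<dots> = mscale a (mat 1) + (\<Sum>i\<le>degree p. mscale (coeff p i) (mpow M (Suc i)))"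
    by (subst sum.atMost_Suc_shift) simp
  finally show ?thesis
    by (simp add: mpoly_def matrix_mult_sum_right mscale_mult_right mpow_Suc)
qed

lemma mpoly_0 [simp]: "mpoly 0 M = 0"
  by (simp add: mpoly_def vec_eq_iff)

lemma mpoly_1 [simp]: "mpoly 1 M = mat 1"
  by (simp add: mpoly_def vec_eq_iff)

lemma mpoly_add: "mpoly (p + q) M = mpoly p M + mpoly q M"
proof -
  have d: "degree (p + q) \<le> max (degree p) (degree q)" by (simp add: degree_add_le)
  show ?thesis
    unfolding mpoly_altdef[OF d] mpoly_altdef[of p, OF max.cobounded1[of _ "degree q"]]
      mpoly_altdef[of q, OF max.cobounded2[of _ "degree p"]]
    by (simp add: sum.distrib[symmetric] vec_eq_iff algebra_simps)
qed

lemma mpoly_smult: "mpoly (smult c p) M = mscale c (mpoly p M)"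
  unfolding mpoly_altdef[OF degree_smult_le]
  by (simp add: mpoly_def vec_eq_iff sum_distrib_left mult.assoc)

lemma mpoly_mult: "mpoly (p * q) M = mpoly p M ** mpoly q M"
proof (induction p)
  case 0
  show ?case by (simp add: matrix_matrix_mult_def vec_eq_iff)
next
  case (pCons a p)
  have "mpoly (pCons a p * q) M = mscale a (mpoly q M) + M ** mpoly (p * q) M"
    by (simp only: mult_pCons_left mpoly_add mpoly_smult mpoly_pCons) (simp add: vec_eq_iff)
  also have "\<dots> = mpoly (pCons a p) M ** mpoly q M"
    by (simp only: pCons mpoly_pCons matrix_add_rdistrib mscale_mult_left matrix_mul_lid matrix_mul_assoc)
  finally show ?case .
qed

lemma mpoly_monom: "mpoly (monom c n) M = mscale c (mpow M n)"
proof -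
  have "mpoly (monom c n) M = (\<Sum>i\<le>n. mscale (coeff (monom c n) i) (mpow M i))"
    by (rule mpoly_altdef) (rule degree_monom_le)
  also have "\<dots> = (\<Sum>i\<in>{n}. mscale (coeff (monom c n) i) (mpow M i))"
    by (rule sum.mono_neutral_right) (auto simp: vec_eq_iff)
  finally show ?thesis by simp
qed

lemma mpoly_linear: "mpoly [:- z, 1:] M ** N = M ** N - mscale z N"
  by (simp add: mpoly_pCons mat_minus_mult mscale_mult_left matrix_add_rdistrib)

lemma mpoly_commute: "mpoly p M ** mpoly q M = mpoly q M ** mpoly p M"
  by (simp add: mpoly_mult[symmetric] mult.commute)

lemma mpoly_eigenvector:
  assumes "M *v v = c *s v"
  shows "mpoly p M *v v = poly p c *s v"
  by (induction p)
    (simp_all add: mpoly_pCons matrix_vector_mult_add_rdistrib mscale_vector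
      matrix_vector_mul_assoc[symmetric] vector_scalar_commute assms
      vector_sadd_rdistrib vector_smult_assoc mult.commute)

lemma eigenvalue_root:
  assumes "c \<in> eigenvalues M" "mpoly p M = 0"
  shows "poly p c = 0"
  using assms mpoly_eigenvector[of M _ c p] by (force simp: eigenvalues_def)

lemma mpoly_in_span:
  assumes "degree p \<le> n"
  shows "mpoly p M \<in> cmat.span (mpow M ` {..n})"
  unfolding mpoly_altdef[OF assms]
  by (intro cmat.span_sum cmat.span_scale cmat.span_base) auto

text \<open>The support condition on the coefficients is what later bounds the degree of a
  polynomial annihilating \<open>A\<close>.\<close>

lemma span_mpow_obtain:
  assumes "X \<in> cmat.span (mpow M ` S)"
  obtains p where "X = mpoly p M" "\<And>i. i \<notin> S \<Longrightarrow> coeff p i = 0"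
proof -
  have "\<exists>p. X = mpoly p M \<and> (\<forall>i. i \<notin> S \<longrightarrow> coeff p i = 0)"
    using assms
  proof (induction rule: cmat.span_induct_alt)
    case base
    show ?case by (rule exI[of _ 0]) simp
  next
    case (step c x y)
    then obtain i p where "i \<in> S" "x = mpow M i" "y = mpoly p M" "\<forall>i. i \<notin> S \<longrightarrow> coeff p i = 0"
      by auto
    then show ?case
      by (intro exI[of _ "monom c i + p"]) (auto simp: mpoly_add mpoly_monom)
  qed
  with that show ?thesis by blast
qed

lemma polynomial_in_iff_span: "polynomial_in X M \<longleftrightarrow> X \<in> cmat.span (range (mpow M))"
proof
  assume "polynomial_in X M"
  then obtain p where "X = mpoly p M" by (auto simp: polynomial_in_def)
  then show "X \<in> cmat.span (range (mpow M))"
    using mpoly_in_span[of p "degree p" M] cmat.span_mono[of "mpow M ` {..degree p}" "range (mpow M)"] by blast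
next
  assume "X \<in> cmat.span (range (mpow M))"
  then show "polynomial_in X M"
    using span_mpow_obtain[of X M UNIV] by (auto simp: polynomial_in_def)
qed

lemma polynomial_in_mult:
  "polynomial_in X M \<Longrightarrow> polynomial_in Y M \<Longrightarrow> polynomial_in (X ** Y) M"
  by (metis mpoly_mult polynomial_in_def)

lemma polynomial_in_commute:
  "polynomial_in X M \<Longrightarrow> polynomial_in Y M \<Longrightarrow> X ** Y = Y ** X"
  by (metis mpoly_commute polynomial_in_def)

lemma polynomial_in_mpow: "polynomial_in (mpow M k) M"
  by (simp add: polynomial_in_iff_span cmat.span_base)

lemma polynomial_in_self: "polynomial_in M M"
  using polynomial_in_mpow[of M 1] by simp

lemma polynomial_in_add:
  "polynomial_in X M \<Longrightarrow> polynomial_in Y M \<Longrightarrow> polynomial_in (X + Y) M"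
  by (simp add: polynomial_in_iff_span cmat.span_add)

lemma polynomial_in_mscale: "polynomial_in X M \<Longrightarrow> polynomial_in (mscale c X) M"
  by (simp add: polynomial_in_iff_span cmat.span_scale)

text \<open>Substituting one polynomial into another. It makes the algebra of \<open>A\<close>
  closed under transposition once the transpose of \<open>A\<close> lies in it.\<close>

lemma polynomial_in_trans:
  assumes "polynomial_in X Y" "polynomial_in Y M"
  shows "polynomial_in X M"
proof -
  obtain p where p: "X = mpoly p Y" using assms(1) by (auto simp: polynomial_in_def)
  have "polynomial_in (mpoly p Y) M"
  proof (induction p)
    case 0
    have "mpoly 0 Y = mpoly 0 M" by simp
    then show ?case unfolding polynomial_in_def by blast
  next
    case (pCons a p)
    then show ?case
      using polynomial_in_mpow[of M 0] assms(2)
      by (simp add: mpoly_pCons polynomial_in_add polynomial_in_mscale polynomial_in_mult)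
  qed
  with p show ?thesis by simp
qed

lemma generated_algebra_eq: "generated_algebra M = {X. polynomial_in X M}"
  unfolding generated_algebra_def
proof (rule hull_unique)
  show "{M} \<subseteq> {X. polynomial_in X M}" using polynomial_in_self by auto
  have "{X. polynomial_in X M} = cmat.span (range (mpow M))" by (auto simp: polynomial_in_iff_span)
  then have "cmat.subspace {X. polynomial_in X M}" by simp
  then show "cmat.subspace {X. polynomial_in X M} \<and> mat 1 \<in> {X. polynomial_in X M} \<and>
    (\<forall>B\<in>{X. polynomial_in X M}. \<forall>C\<in>{X. polynomial_in X M}. B ** C \<in> {X. polynomial_in X M})"
    using polynomial_in_mpow[of M 0] by (simp add: polynomial_in_mult)
next
  fix T assume T: "{M} \<subseteq> T" "cmat.subspace T \<and> mat 1 \<in> T \<and> (\<forall>B\<in>T. \<forall>C\<in>T. B ** C \<in> T)"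
  have "mpow M k \<in> T" for k
    using T by (induction k) (auto simp: mpow_Suc)
  then have "cmat.span (range (mpow M)) \<subseteq> T" using T by (intro cmat.span_minimal) auto
  then show "{X. polynomial_in X M} \<subseteq> T" by (auto simp: polynomial_in_iff_span)
qed

lemma transpose_mscale: "transpose (mscale c M) = mscale c (transpose M)"
  by (simp add: vec_eq_iff transpose_def)

lemma transpose_add: "transpose (M + N :: complex^'n^'n) = transpose M + transpose N"
  by (simp add: vec_eq_iff transpose_def)

lemma mpoly_transpose: "transpose (mpoly p M) = mpoly p (transpose M)"
proof (induction p)
  case 0
  then show ?case by (simp add: vec_eq_iff transpose_def)
next
  case (pCons a p)
  \<comment> \<open>Transposition reverses the order of factors. Writing the last factor as a
    polynomial in the transpose lets the two factors be swapped back.\<close>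
  have "transpose (mpoly (pCons a p) M) = mscale a (mat 1) + mpoly p (transpose M) ** mpoly [:0, 1:] (transpose M)"
    by (simp add: mpoly_pCons transpose_add transpose_mscale matrix_transpose_mul transpose_mat pCons)
  then show ?case by (subst (asm) mpoly_commute) (simp add: mpoly_pCons)
qed

section \<open>Normal matrices\<close>

text \<open>The conjugate transpose.\<close>

definition adjm :: "complex^'n^'n \<Rightarrow> complex^'n^'n" where
  "adjm M = (\<chi> i j. cnj (M $ j $ i))"

lemma adjm_nth [simp]: "adjm M $ i $ j = cnj (M $ j $ i)"
  by (simp add: adjm_def)

lemma adjm_adjm [simp]: "adjm (adjm M) = M"
  by (simp add: vec_eq_iff)

lemma inner_complex_eq: "(x :: complex) \<bullet> y = Re (x * cnj y)"
  by (simp add: inner_complex_def)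

text \<open>The inner product on complex vectors is real-valued, the real part of the Hermitian
  form; the conjugate transpose is the adjoint for it as well.\<close>

lemma adjm_inner: "(M *v u) \<bullet> v = u \<bullet> (adjm M *v v)"
proof -
  have "(M *v u) \<bullet> v = Re (\<Sum>i\<in>UNIV. \<Sum>j\<in>UNIV. M $ i $ j * u $ j * cnj (v $ i))"
    by (simp add: inner_vec_def inner_complex_eq matrix_vector_mult_def sum_distrib_right)
  also have "\<dots> = Re (\<Sum>j\<in>UNIV. \<Sum>i\<in>UNIV. M $ i $ j * u $ j * cnj (v $ i))"
    by (subst sum.swap) simp
  also have "\<dots> = u \<bullet> (adjm M *v v)"
    by (simp add: inner_vec_def inner_complex_eq matrix_vector_mult_def sum_distrib_left mult_ac)
  finally show ?thesis .
qed

lemma scale_inner: "(c *s u) \<bullet> (v :: complex^'n) = u \<bullet> (cnj c *s v)"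
  by (simp add: inner_vec_def inner_complex_eq mult_ac)

text \<open>Expand the squared norm of \<open>adjm M *v v - cnj c *s v\<close>: by normality each
  product in the expansion equals the same number, so the norm is zero.\<close>

lemma adjm_eigenvector:
  assumes normal: "M ** adjm M = adjm M ** M" and v: "M *v v = c *s v"
  shows "adjm M *v v = cnj c *s v"
proof -
  let ?w = "adjm M *v v"
  have 1: "?w \<bullet> ?w = v \<bullet> ((cnj c * c) *s v)"
  proof -
    have "?w \<bullet> ?w = v \<bullet> (M *v (adjm M *v v))" by (simp add: adjm_inner)
    also have "\<dots> = v \<bullet> (adjm M *v (M *v v))" by (simp add: matrix_vector_mul_assoc normal)
    also have "\<dots> = (M *v v) \<bullet> (M *v v)" by (simp add: adjm_inner)
    finally show ?thesis by (simp add: v scale_inner vector_smult_assoc)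
  qed
  have 2: "?w \<bullet> (cnj c *s v) = v \<bullet> ((cnj c * c) *s v)"
    by (simp add: adjm_inner vector_scalar_commute v vector_smult_assoc)
  have 3: "(cnj c *s v) \<bullet> (cnj c *s v) = v \<bullet> ((cnj c * c) *s v)"
    by (simp add: scale_inner vector_smult_assoc mult.commute)
  have "(?w - cnj c *s v) \<bullet> (?w - cnj c *s v) = 0"
    using 1 2 3 by (simp add: inner_diff_left inner_diff_right inner_commute)
  then show ?thesis by simp
qed


section \<open>Bases of eigenvectors of normal matrices\<close>

text \<open>Take a nonzero polynomial \<open>p\<close> of least degree with
  \<open>mpoly p M *v u = 0\<close> and split off a linear factor at a root \<open>z\<close>. The
  cofactor applied to \<open>u\<close> is nonzero by minimality, lies in \<open>S\<close>, and is an
  eigenvector for \<open>z\<close>.\<close>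

lemma eigenvector_in_invariant_subspace:
  fixes M :: "complex^'n^'n"
  assumes S: "vec.subspace S" "\<And>v. v \<in> S \<Longrightarrow> M *v v \<in> S" and u: "u \<in> S" "u \<noteq> 0"
  obtains v c where "v \<in> S" "v \<noteq> 0" "M *v v = c *s v"
proof -
  have "\<exists>p. p \<noteq> 0 \<and> mpoly p M *v u = 0"
  \<comment> \<open>Linear dependence concerns a set of vectors, so a repetition among the vectors
    \<open>mpow M i *v u\<close> is treated separately; it gives the difference of two
    monomials.\<close>
  proof (cases "inj_on (\<lambda>i. mpow M i *v u) {..CARD('n)}")
    case False
    then obtain i j where ij: "i \<noteq> j" "mpow M i *v u = mpow M j *v u"
      by (auto simp: inj_on_def)
    then have "coeff (monom 1 i + monom (- 1) j) i \<noteq> (0 :: complex)" by simp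
    then have "monom 1 i + monom (- 1) j \<noteq> (0 :: complex poly)" by (metis coeff_0)
    moreover have "mpoly (monom 1 i + monom (- 1) j) M *v u = 0"
      using ij by (simp add: mpoly_add mpoly_monom matrix_vector_mult_diff_rdistrib)
    ultimately show ?thesis by blast
  next
    case True
    let ?g = "\<lambda>i. mpow M i *v u"
    let ?B = "?g ` {..CARD('n)}"
    have "card ?B = CARD('n) + 1" using card_image[OF True] by simp
    moreover have "vec.dim ?B \<le> CARD('n)"
      using vec.dim_subset[of ?B "UNIV :: (complex^'n) set"] unfolding vec_dim_card by simp
    ultimately have "vec.dependent ?B"
      using vec.dim_eq_card_independent[of ?B] by linarith
    then obtain a v where a: "v \<in> ?B" "a v \<noteq> 0" "(\<Sum>v\<in>?B. a v *s v) = 0"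
      by (auto simp: vec.dependent_finite)
    then obtain i where i: "i \<le> CARD('n)" "a (?g i) \<noteq> 0" by auto
    let ?p = "\<Sum>i\<le>CARD('n). monom (a (?g i)) i"
    have *: "mpoly (\<Sum>i\<in>I. monom (b i) i) M *v u = (\<Sum>i\<in>I. b i *s ?g i)"
      for b :: "nat \<Rightarrow> complex" and I :: "nat set"
      by (induction I rule: infinite_finite_induct)
        (simp_all add: mpoly_add mpoly_monom matrix_vector_mult_add_rdistrib mscale_vector)
    have "mpoly ?p M *v u = 0"
      using a(3) unfolding * by (simp add: sum.reindex[OF True])
    moreover have "?p \<noteq> 0"
    proof
      assume p0: "?p = 0"
      have "a (?g i) = coeff ?p i" using i(1) by (simp add: coeff_sum)
      also have "\<dots> = 0" by (simp only: p0 coeff_0)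
      finally show False using i(2) by simp
    qed
    ultimately show ?thesis by blast
  qed
  then obtain p where p: "p \<noteq> 0" "mpoly p M *v u = 0"
    and least: "\<And>q. q \<noteq> 0 \<and> mpoly q M *v u = 0 \<Longrightarrow> degree p \<le> degree q"
    using ex_has_least_nat[of "\<lambda>p. p \<noteq> 0 \<and> mpoly p M *v u = 0" _ degree] by blast
  have "degree p \<noteq> 0"
  proof
    assume "degree p = 0"
    then obtain a where a: "p = [:a:]" by (metis degree_eq_zeroE)
    with p(2) have "a *s u = 0" by (simp add: mpoly_pCons mscale_vector)
    with a p(1) u(2) show False by simp
  qed
  then obtain z where "poly p z = 0"
    using fundamental_theorem_of_algebra[of p] constant_degree[of p] by auto
  then obtain q where q: "p = [:- z, 1:] * q" by (metis dvdE poly_eq_0_iff_dvd)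
  let ?w = "mpoly q M *v u"
  have q0: "q \<noteq> 0" using p(1) q by auto
  then have "degree p = degree q + 1" by (subst q, subst degree_mult_eq) auto
  with least[of q] q0 have "?w \<noteq> 0" by auto
  moreover have "M *v ?w = z *s ?w"
    using p(2) unfolding q mpoly_mult mpoly_linear
    by (simp add: matrix_vector_mult_diff_rdistrib mscale_vector matrix_vector_mul_assoc)
  moreover have "mpoly r M *v u \<in> S" for r
    by (induction r)
      (use S u in \<open>simp_all add: mpoly_pCons matrix_vector_mult_add_rdistrib mscale_vector
        matrix_vector_mul_assoc[symmetric] vec.subspace_add vec.subspace_scale vec.subspace_0\<close>)
  ultimately show ?thesis using that by blast
qed

text \<open>By normality the adjoint preserves the span of the eigenvectors, so \<open>M\<close>
  preserves its orthogonal complement. A nonzero complement would contain an eigenvector, which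
  would be orthogonal to itself.\<close>

lemma normal_eigenvectors_span:
  fixes M :: "complex^'n^'n"
  assumes normal: "M ** adjm M = adjm M ** M"
  shows "vec.span {v. \<exists>c. M *v v = c *s v} = UNIV" (is "vec.span ?E = UNIV")
proof (rule ccontr)
  let ?W = "vec.span ?E"
  assume ne: "?W \<noteq> UNIV"
  \<comment> \<open>Orthogonal complements are taken over the reals, so the complex span is also
    regarded as a real subspace.\<close>
  have scaleR: "r *\<^sub>R v = complex_of_real r *s v" for r and v :: "complex^'n"
    by (simp only: vec_eq_iff vector_scaleR_component vector_smult_component) (simp add: scaleR_conv_of_real)
  have W: "subspace ?W"
    by (auto simp: subspace_def vec.span_zero vec.span_add scaleR vec.span_scale)
  have "dim ?W < DIM(complex^'n)"
    using ne dim_eq_full[of ?W] dim_subset_UNIV[of ?W] W by (auto simp: span_eq_iff[THEN iffD2])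
  then obtain x where x: "x \<noteq> 0" "\<And>y. y \<in> ?W \<Longrightarrow> x \<bullet> y = 0"
    by (rule orthogonal_to_subspace_exists) (use W in \<open>auto simp: orthogonal_def span_eq_iff[THEN iffD2]\<close>)
  let ?S = "{x. \<forall>y\<in>?W. x \<bullet> y = 0}"
  have adj: "adjm M *v w \<in> ?W" if "w \<in> ?W" for w
    using that
  proof (induction rule: vec.span_induct_alt)
    case base
    show ?case by (simp add: vec.span_zero)
  next
    case (step c x y)
    then obtain b where b: "M *v x = b *s x" by auto
    have "x \<in> ?W" using step by (intro vec.span_base) auto
    then have "adjm M *v x \<in> ?W"
      unfolding adjm_eigenvector[OF normal b] by (rule vec.span_scale)
    with step show ?case
      by (simp add: matrix_vector_right_distrib vector_scalar_commute vec.span_add vec.span_scale)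
  qed
  \<comment> \<open>The real orthogonal complement of a complex subspace is closed under complex
    scaling, since the scalar moves to the other side as its conjugate.\<close>
  have "vec.subspace ?S"
    by (auto simp: vec.subspace_def inner_add_left scale_inner vec.span_scale)
  moreover have "M *v v \<in> ?S" if "v \<in> ?S" for v
    using that adj by (simp add: adjm_inner)
  moreover have "x \<in> ?S" using x by simp
  ultimately obtain v c where v: "v \<in> ?S" "v \<noteq> 0" "M *v v = c *s v"
    using x(1) by (rule eigenvector_in_invariant_subspace)
  then have "v \<in> ?W" by (auto intro: vec.span_base)
  with v(1,2) show False by auto
qed

text \<open>The columns of \<open>P\<close> are eigenvectors but are not made orthonormal: an
  inverse \<open>Q\<close> suffices for the trace, the determinant and the eigenvalues.\<close>

lemma normal_diagonalizable:
  fixes M :: "complex^'n^'n"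
  assumes normal: "M ** adjm M = adjm M ** M"
  obtains P Q :: "complex^'n^'n" and ev where "P ** Q = mat 1" "Q ** P = mat 1"
    "\<And>j. M *v column j P = ev j *s column j P"
proof -
  let ?E = "{v. \<exists>c. M *v v = c *s v}"
  obtain B where B: "B \<subseteq> ?E" "vec.independent B" "?E \<subseteq> vec.span B"
    by (rule vec.maximal_independent_subset)
  have sp: "vec.span B = UNIV"
    using vec.span_minimal[OF B(3) vec.subspace_span] normal_eigenvectors_span[OF normal] by auto
  have fin: "finite B" using B(2) by (rule vec.finiteI_independent)
  have "card B = CARD('n)"
    using vec.dim_eq_card_independent[OF B(2)] vec.dim_span[of B] unfolding sp vec_dim_card by simp
  then obtain f where f: "bij_betw f (UNIV :: 'n set) B"
    using finite_same_card_bij[of "UNIV :: 'n set" B] fin by auto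
  define P where "P = (\<chi> i j. f j $ i)"
  have col: "column j P = f j" for j by (simp add: P_def column_def vec_eq_iff)
  have "columns P = B"
    using f by (auto simp: columns_def col bij_betw_def)
  then obtain Q where Q: "P ** Q = mat 1"
    using sp matrix_right_invertible_span_columns[of P] by auto
  have "\<forall>j. \<exists>c. M *v f j = c *s f j"
    using f B(1) by (auto simp: bij_betw_def)
  then obtain ev where "\<And>j. M *v f j = ev j *s f j" by metis
  with Q show ?thesis
    by (intro that[of P Q ev]) (simp_all add: matrix_left_right_inverse[of P Q] col)
qed

section \<open>Trace, characteristic polynomial and spectrum from an eigenbasis\<close>

text \<open>Stated over a commutative ring because it is applied to polynomial matrices too.\<close>

lemma matrix_mult_diagonal:
  fixes X P :: "'a::comm_ring_1^'n^'n"
  assumes "\<And>j. X *v column j P = f j *s column j P"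
  shows "X ** P = P ** (\<chi> i j. if i = j then f j else 0)"
proof -
  have "(X ** P) $ i $ j = f j * P $ i $ j" for i j
    using assms[of j] by (simp add: vec_eq_iff matrix_vector_mult_def matrix_matrix_mult_def column_def)
  then show ?thesis
    by (simp add: vec_eq_iff matrix_matrix_mult_def if_distrib mult.commute cong: if_cong)
qed

lemma trace_eigenbasis:
  fixes X P Q :: "complex^'n^'n"
  assumes "P ** Q = mat 1" "Q ** P = mat 1" "\<And>j. X *v column j P = f j *s column j P"
  shows "trace X = (\<Sum>j\<in>UNIV. f j)"
proof -
  let ?D = "(\<chi> i j. if i = j then f j else 0) :: complex^'n^'n"
  have "trace X = trace ((X ** P) ** Q)"
    by (simp add: matrix_mul_assoc[symmetric] assms(1))
  also have "\<dots> = trace (Q ** (P ** ?D))"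
    by (subst trace_mul_sym) (simp only: matrix_mult_diagonal[OF assms(3)])
  also have "\<dots> = trace ?D" by (simp add: matrix_mul_assoc assms(2))
  finally show ?thesis by (simp add: trace_def)
qed

text \<open>The columns of \<open>P\<close>, read as constant polynomials, are eigenvectors of the
  characteristic matrix with eigenvalues \<open>[:- ev j, 1:]\<close>. Taking determinants, the
  nonzero determinant of the lifted \<open>P\<close> cancels.\<close>

lemma charpoly_eigenbasis:
  fixes M P Q :: "complex^'n^'n"
  assumes PQ: "P ** Q = mat 1" and ev: "\<And>j. M *v column j P = ev j *s column j P"
  shows "charpoly M = (\<Prod>j\<in>UNIV. [:- ev j, 1:])"
proof -
  let ?C = "map_matrix (\<lambda>a. [:a:])" and ?X = "mat [:0, 1:] - map_matrix (\<lambda>a. [:a:]) M"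
  have C_sum: "[:\<Sum>k\<in>S. f k:] = (\<Sum>k\<in>S. [:f k:])" for f :: "'n \<Rightarrow> complex" and S
    by (rule poly_eqI) (auto simp: coeff_sum coeff_pCons split: nat.splits)
  have C_mult: "?C (A ** B) = ?C A ** ?C B" for A B :: "complex^'n^'n"
    by (simp add: vec_eq_iff matrix_matrix_mult_def C_sum mult.commute)
  have "?C (mat 1) = (mat 1 :: complex poly^'n^'n)" by (simp add: vec_eq_iff mat_def)
  then have "det (?C P) * det (?C Q) = 1"
    by (metis C_mult PQ det_I det_mul)
  then have nz: "det (?C P) \<noteq> 0" by auto
  have "?X *v column j (?C P) = [:- ev j, 1:] *s column j (?C P)" for j
  proof -
    have 1: "(\<Sum>k\<in>UNIV. M $ i $ k * P $ k $ j) = ev j * P $ i $ j" for i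
      using ev[of j] by (simp add: vec_eq_iff matrix_vector_mult_def column_def)
    have 2: "(\<Sum>k\<in>UNIV. [:M $ i $ k:] * [:P $ k $ j:]) = [:ev j * P $ i $ j:]" for i
      using 1[of i] by (simp add: C_sum[symmetric] mult.commute)
    have 3: "(\<Sum>k\<in>UNIV. (if i = k then [:0, 1:] else 0) * [:P $ k $ j:]) = [:0, 1:] * [:P $ i $ j:]" for i
    proof -
      have "(\<Sum>k\<in>UNIV. (if i = k then [:0, 1:] else 0) * [:P $ k $ j:]) =
        (\<Sum>k\<in>UNIV. if i = k then [:0, 1:] * [:P $ k $ j:] else 0)"
        by (intro sum.cong) auto
      then show ?thesis by (simp only: sum.delta'[OF finite_class.finite_UNIV] UNIV_I if_True)
    qed
    show ?thesis
      by (simp add: vec_eq_iff matrix_vector_mult_def column_def mat_def left_diff_distrib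
          sum_subtractf 2 3 del: mult_pCons_left mult_pCons_right) simp
  qed
  then have "?X ** ?C P = ?C P ** (\<chi> i j. if i = j then [:- ev j, 1:] else 0)"
    by (rule matrix_mult_diagonal)
  from arg_cong[OF this, of det] have "det ?X * det (?C P) =
      det (?C P) * det ((\<chi> i j. if i = j then [:- ev j, 1:] else 0) :: complex poly^'n^'n)"
    by (simp only: det_mul)
  then have "det ?X = det ((\<chi> i j. if i = j then [:- ev j, 1:] else 0) :: complex poly^'n^'n)"
    using nz by (simp add: mult.commute)
  also have "\<dots> = (\<Prod>j\<in>UNIV. [:- ev j, 1:])"
    by (subst det_diagonal) simp_all
  finally show ?thesis by (simp add: charpoly_def)
qed

lemma order_prod_linear:
  assumes "finite S"
  shows "order c (\<Prod>j\<in>S. [:- ev j, 1:]) = card {j \<in> S. ev j = (c :: complex)}"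
  using assms
proof (induction S rule: finite_induct)
  case empty
  show ?case by (simp add: order_0I)
next
  case (insert x S)
  have lin: "order c [:- ev x, 1:] = (if ev x = c then 1 else 0)"
    using order_power_n_n[of c 1] by (auto intro: order_0I)
  have "(\<Prod>j\<in>insert x S. [:- ev j, 1:]) \<noteq> 0" using insert.hyps by (subst prod_zero_iff) auto
  then have "order c (\<Prod>j\<in>insert x S. [:- ev j, 1:]) =
      order c [:- ev x, 1:] + card {j \<in> S. ev j = c}"
    using insert by (simp add: order_mult del: mult_pCons_left)
  moreover have "{j \<in> insert x S. ev j = c} =
      (if ev x = c then insert x {j \<in> S. ev j = c} else {j \<in> S. ev j = c})"
    by auto
  ultimately show ?case using insert.hyps lin by simp
qed

lemma eigenvalues_eigenbasis:
  fixes M P Q :: "complex^'n^'n"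
  assumes PQ: "P ** Q = mat 1" "Q ** P = mat 1" and ev: "\<And>j. M *v column j P = ev j *s column j P"
  shows "eigenvalues M = range ev"
proof (intro equalityI subsetI)
  fix c assume "c \<in> range ev"
  then obtain j where j: "c = ev j" by auto
  have "column j P \<noteq> 0"
  proof
    assume "column j P = 0"
    then have "\<And>i. P $ i $ j = 0" by (simp add: column_def vec_eq_iff)
    then have "(Q ** P) $ j $ j = 0" by (simp add: matrix_matrix_mult_def)
    then show False by (simp add: PQ mat_def)
  qed
  then show "c \<in> eigenvalues M" using ev j by (auto simp: eigenvalues_def)
next
  fix c assume "c \<in> eigenvalues M"
  then obtain v where v: "v \<noteq> 0" "M *v v = c *s v" by (auto simp: eigenvalues_def)
  let ?D = "(\<chi> i j. if i = j then ev j else 0) :: complex^'n^'n" and ?w = "Q *v v"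
  have Pw: "P *v ?w = v" by (simp add: matrix_vector_mul_assoc PQ)
  have "P *v (?D *v ?w) = (M ** P) *v ?w"
    by (simp only: matrix_vector_mul_assoc[of P] matrix_mult_diagonal[OF ev])
  also have "\<dots> = M *v v"
    by (simp only: matrix_vector_mul_assoc[symmetric, of M] Pw)
  finally have "P *v (?D *v ?w) = M *v v" .
  then have "Q *v (P *v (?D *v ?w)) = c *s ?w" by (simp add: v vector_scalar_commute)
  then have Dw: "?D *v ?w = c *s ?w" by (simp add: matrix_vector_mul_assoc matrix_mul_assoc PQ)
  have "?w \<noteq> 0" using Pw v(1) by auto
  \<comment> \<open>In the coordinates \<open>?w\<close> the matrix is diagonal, so a nonzero
    coordinate \<open>j\<close> forces \<open>ev j = c\<close>.\<close>
  then obtain j where j: "?w $ j \<noteq> 0" by (auto simp: vec_eq_iff)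
  have "(?D *v ?w) $ j = ev j * ?w $ j"
    by (simp add: matrix_vector_mult_def if_distrib[of "\<lambda>x. x * _"] cong: if_cong)
  with Dw j have "ev j = c" by simp
  then show "c \<in> range ev" by auto
qed

lemma adjm_mpoly_eigenvector:
  fixes M :: "complex^'n^'n"
  assumes normal: "M ** adjm M = adjm M ** M" and v: "M *v v = c *s v"
  shows "adjm (mpoly q M) *v v = cnj (poly q c) *s v"
proof (induction q)
  case 0
  have "adjm 0 = (0 :: complex^'n^'n)" by (simp add: vec_eq_iff)
  then show ?case by simp
next
  case (pCons a q)
  have "adjm (mpoly (pCons a q) M) = mscale (cnj a) (mat 1) + adjm (mpoly q M) ** adjm M"
    by (auto simp: mpoly_pCons vec_eq_iff matrix_matrix_mult_def mat_def mult.commute)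
  then show ?case
    by (simp add: matrix_vector_mult_add_rdistrib mscale_vector matrix_vector_mul_assoc[symmetric]
        adjm_eigenvector[OF assms] vector_scalar_commute pCons vector_sadd_rdistrib vector_smult_assoc)
qed

text \<open>Each basis vector is an eigenvector of both factors, so the trace is a sum over the
  basis; grouping equal eigenvalues produces the multiplicities.\<close>

lemma normal_trace_product:
  fixes M :: "complex^'n^'n"
  assumes normal: "M ** adjm M = adjm M ** M"
  shows "trace (mpoly p M ** adjm (mpoly q M)) =
    (\<Sum>c\<in>eigenvalues M. of_nat (eig_mult M c) * (poly p c * cnj (poly q c)))"
    and "c \<in> eigenvalues M \<Longrightarrow> eig_mult M c > 0"
    and "finite (eigenvalues M)"
proof -
  obtain P Q :: "complex^'n^'n" and ev where PQ: "P ** Q = mat 1" "Q ** P = mat 1"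
    and ev: "\<And>j. M *v column j P = ev j *s column j P"
    using normal_diagonalizable[OF normal] by blast
  have ran: "eigenvalues M = range ev" using eigenvalues_eigenbasis[OF PQ ev] .
  then show "finite (eigenvalues M)" by simp
  have mult: "eig_mult M c = card {j. ev j = c}" for c
    unfolding eig_mult_def charpoly_eigenbasis[OF PQ(1) ev] by (subst order_prod_linear) simp_all
  show "eig_mult M c > 0" if "c \<in> eigenvalues M"
    using that by (auto simp: ran mult card_gt_0_iff)
  have "trace (mpoly p M ** adjm (mpoly q M)) = (\<Sum>j\<in>UNIV. poly p (ev j) * cnj (poly q (ev j)))"
    by (rule trace_eigenbasis[OF PQ])
      (simp add: matrix_vector_mul_assoc[symmetric] adjm_mpoly_eigenvector[OF normal ev]
        vector_scalar_commute mpoly_eigenvector[OF ev] vector_smult_assoc mult.commute)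
  also have "\<dots> = (\<Sum>c\<in>eigenvalues M. \<Sum>j\<in>{j\<in>UNIV. ev j = c}. poly p (ev j) * cnj (poly q (ev j)))"
    unfolding ran by (rule sum.image_gen) simp
  also have "\<dots> = (\<Sum>c\<in>eigenvalues M. of_nat (eig_mult M c) * (poly p c * cnj (poly q c)))"
    by (intro sum.cong refl) (simp add: mult)
  finally show "trace (mpoly p M ** adjm (mpoly q M)) = \<dots>" .
qed

text \<open>Links the spectral trace formula with the real inner product of matrices, in which all
  orthogonality arguments take place.\<close>

lemma Re_trace_adjm: "Re (trace (X ** adjm Y)) = X \<bullet> Y"
  by (simp add: trace_def matrix_matrix_mult_def inner_vec_def inner_complex_eq)

text \<open>The squared norm of \<open>mpoly p M\<close> is a combination of the values of
  \<open>p\<close> at the eigenvalues times their conjugates.\<close>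

lemma normal_mpoly_eq_0:
  fixes M :: "complex^'n^'n"
  assumes "M ** adjm M = adjm M ** M" "\<And>c. c \<in> eigenvalues M \<Longrightarrow> poly p c = 0"
  shows "mpoly p M = 0"
proof -
  have "mpoly p M \<bullet> mpoly p M = 0"
    by (simp add: Re_trace_adjm[symmetric] normal_trace_product(1)[OF assms(1)] assms(2))
  then show ?thesis by simp
qed

lemma adjm_mult: "adjm (M ** N) = adjm N ** adjm M"
  by (simp add: vec_eq_iff matrix_matrix_mult_def mult.commute)

lemma scaleR_matrix: "r *\<^sub>R M = mscale (of_real r) M"
  by (simp only: vec_eq_iff vector_scaleR_component mscale_nth) (simp add: scaleR_conv_of_real)

lemma trace_adjm_real:
  assumes "\<And>x y. Im (M $ x $ y) = 0" "\<And>x y. Im (N $ x $ y) = 0"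
  shows "trace (M ** adjm N) = of_real (M \<bullet> N)"
proof -
  have "Im (trace (M ** adjm N)) = 0"
    by (simp add: trace_def matrix_matrix_mult_def assms)
  then show ?thesis by (simp add: complex_eq_iff Re_trace_adjm)
qed

section \<open>Monic polynomials with prescribed simple roots\<close>

text \<open>On the whole spectrum of a normal matrix this is its minimal polynomial; with one
  eigenvalue removed it is an unnormalized Lagrange interpolation polynomial.\<close>

definition annihilator :: "complex set \<Rightarrow> complex poly" where
  "annihilator E = (\<Prod>c\<in>E. [:- c, 1:])"

lemma poly_annihilator: "poly (annihilator E) z = (\<Prod>c\<in>E. z - c)"
  by (simp add: annihilator_def poly_prod algebra_simps)

lemma degree_annihilator: "finite E \<Longrightarrow> degree (annihilator E) = card E"
  unfolding annihilator_def by (subst degree_prod_eq_sum_degree) auto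

lemma coeff_annihilator: "finite E \<Longrightarrow> coeff (annihilator E) (card E) = 1"
proof -
  assume "finite E"
  then have "coeff (annihilator E) (card E) = lead_coeff (annihilator E)"
    by (simp add: degree_annihilator)
  also have "\<dots> = 1" unfolding annihilator_def lead_coeff_prod by simp
  finally show ?thesis .
qed

lemma normal_annihilator:
  assumes "M ** adjm M = adjm M ** M"
  shows "mpoly (annihilator (eigenvalues M)) M = 0"
  by (rule normal_mpoly_eq_0[OF assms])
    (auto simp: poly_annihilator normal_trace_product(3)[OF assms])

section \<open>Distances and powers of the adjacency matrix\<close>

text \<open>Matrices are indexed by the whole vertex type, hence \<open>verts_UNIV\<close>.\<close>

locale strong_digraph = digraph G
  for G :: "('v::finite, 'e) pre_digraph" +
  assumes verts_UNIV: "verts G = UNIV" and strong: "strongly_connected G"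
begin

abbreviation A :: "complex^'v^'v" where "A \<equiv> adj_matrix G"
abbreviation Ad :: "nat \<Rightarrow> complex^'v^'v" where "Ad \<equiv> dist_matrix G"
abbreviation D :: nat where "D \<equiv> diam G"
abbreviation dd :: "'v \<Rightarrow> 'v \<Rightarrow> nat" where "dd \<equiv> ddist G"

lemma adj_nth: "A $ x $ y = (if x \<rightarrow>\<^bsub>G\<^esub> y then 1 else 0)"
  by (simp add: adj_matrix_def)

lemma dist_nth: "Ad i $ x $ y = (if dd x y = i then 1 else 0)"
  by (simp add: dist_matrix_def)

text \<open>The entry is the number of walks, but only its being a natural number and the criterion
  for positivity are recorded; nothing more is needed.\<close>

lemma mpow_counts_walks:
  "\<exists>m :: nat. mpow A k $ x $ y = of_nat m \<and> (m > 0 \<longleftrightarrow> (\<exists>p. awalk x p y \<and> length p = k))"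
proof (induction k arbitrary: x)
  case 0
  show ?case
    by (rule exI[of _ "of_bool (x = y)"]) (auto simp: mat_def awalk_Nil_iff verts_UNIV)
next
  case (Suc k)
  then obtain m :: "'v \<Rightarrow> nat" where m: "\<And>z. mpow A k $ z $ y = of_nat (m z)"
    "\<And>z. m z > 0 \<longleftrightarrow> (\<exists>p. awalk z p y \<and> length p = k)"
    by metis
  let ?m = "\<Sum>z\<in>UNIV. if x \<rightarrow>\<^bsub>G\<^esub> z then m z else 0"
  have "mpow A (Suc k) $ x $ y = (\<Sum>z\<in>UNIV. of_nat (if x \<rightarrow>\<^bsub>G\<^esub> z then m z else 0))"
    unfolding mpow_Suc matrix_matrix_mult_def by (auto simp: adj_nth m(1) intro!: sum.cong)
  then have 1: "mpow A (Suc k) $ x $ y = of_nat ?m" by (simp only: of_nat_sum)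
  have 2: "?m > 0 \<longleftrightarrow> (\<exists>z. x \<rightarrow>\<^bsub>G\<^esub> z \<and> m z > 0)"
    by (auto simp: neq0_conv[symmetric] simp del: neq0_conv)
  have 3: "(\<exists>z. x \<rightarrow>\<^bsub>G\<^esub> z \<and> m z > 0) \<longleftrightarrow> (\<exists>p. awalk x p y \<and> length p = Suc k)"
  proof
    assume "\<exists>z. x \<rightarrow>\<^bsub>G\<^esub> z \<and> m z > 0"
    then obtain e p where "e \<in> arcs G" "tail G e = x" "awalk (head G e) p y" "length p = k"
      by (auto simp: m(2) arcs_ends_conv)
    then show "\<exists>p. awalk x p y \<and> length p = Suc k"
      by (intro exI[of _ "e # p"]) (simp add: awalk_Cons_iff)
  next
    assume "\<exists>p. awalk x p y \<and> length p = Suc k"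
    then obtain e p where "awalk x (e # p) y" "length p = k" by (auto simp: length_Suc_conv)
    then show "\<exists>z. x \<rightarrow>\<^bsub>G\<^esub> z \<and> m z > 0"
      by (intro exI[of _ "head G e"]) (auto simp: m(2) awalk_Cons_iff arcs_ends_conv)
  qed
  show ?case by (intro exI[of _ ?m] conjI) (rule 1, simp only: 2 3)
qed

text \<open>Cutting out closed subwalks. Powers of \<open>A\<close> see walks, whereas
  \<open>ddist\<close> is defined by paths without repeated vertices.\<close>

lemma apath_of_awalk:
  "awalk x p y \<Longrightarrow> \<exists>q. apath x q y \<and> length q \<le> length p"
proof (induction "length p" arbitrary: p rule: less_induct)
  case less
  show ?case
  proof (cases "distinct (awalk_verts x p)")
    case True
    with less.prems show ?thesis by (auto simp: apath_def)
  next
    case False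
    from awalk_not_distinct_decomp[OF less.prems False]
    obtain q r s w where *: "p = q @ r @ s" "0 < length r" "awalk x q w" "awalk w s y" by blast
    then have "awalk x (q @ s) y" "length (q @ s) < length p" by (auto intro: awalk_appendI)
    from less.hyps[OF this(2,1)] *(1) show ?thesis by auto
  qed
qed

lemma ddist_le: "awalk x p y \<Longrightarrow> dd x y \<le> length p"
  using apath_of_awalk[of x p y] by (auto simp: ddist_def intro: order.trans[OF Least_le])

lemma ddist_walk: "\<exists>p. awalk x p y \<and> length p = dd x y"
proof -
  have "x \<rightarrow>\<^sup>*\<^bsub>G\<^esub> y" using strong by (auto simp: strongly_connected_def verts_UNIV)
  then obtain p where "apath x p y" by (auto simp: reachable_apath)
  then have "\<exists>n p. apath x p y \<and> length p = n" by blast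
  then have "\<exists>p. apath x p y \<and> length p = dd x y"
    unfolding ddist_def by (rule LeastI_ex)
  then show ?thesis by (auto simp: apath_def)
qed

lemma mpow_real: "mpow A k $ x $ y = of_real (Re (mpow A k $ x $ y))" "Re (mpow A k $ x $ y) \<ge> 0"
  using mpow_counts_walks[of k x y] by auto

lemma mpow_ddist: "mpow A (dd x y) $ x $ y \<noteq> 0"
  using mpow_counts_walks[of "dd x y" x y] ddist_walk[of x y] by auto

lemma mpow_below: "k < dd x y \<Longrightarrow> mpow A k $ x $ y = 0"
  using mpow_counts_walks[of k x y] ddist_le[of x _ y] by fastforce

text \<open>The distance is the least exponent at which the entry of the power of \<open>A\<close>
  is nonzero.\<close>

lemma ddist_cong:
  assumes "\<And>k. mpow A k $ x $ y = mpow A k $ u $ v"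
  shows "dd x y = dd u v"
  by (metis assms linorder_neqE_nat mpow_below mpow_ddist)

lemma ddist_0 [simp]: "dd x y = 0 \<longleftrightarrow> x = y"
proof
  assume "dd x y = 0"
  then show "x = y" using ddist_walk[of x y] by (auto simp: awalk_Nil_iff)
next
  assume "x = y"
  then show "dd x y = 0" using ddist_le[of x "[]" y] by (auto simp: awalk_Nil_iff verts_UNIV)
qed

lemma ddist_step: "x \<rightarrow>\<^bsub>G\<^esub> y \<Longrightarrow> dd z y \<le> Suc (dd z x)"
proof -
  assume "x \<rightarrow>\<^bsub>G\<^esub> y"
  then obtain e where e: "e \<in> arcs G" "tail G e = x" "head G e = y" by (auto simp: arcs_ends_conv)
  obtain p where p: "awalk z p x" "length p = dd z x" using ddist_walk by blast
  have "awalk x [e] y" using e by (simp add: awalk_Cons_iff awalk_Nil_iff verts_UNIV)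
  then have "awalk z (p @ [e]) y" using p(1) by (rule awalk_appendI[rotated])
  from ddist_le[OF this] p show ?thesis by simp
qed

lemma ddist_1: "dd x y = Suc 0 \<longleftrightarrow> x \<rightarrow>\<^bsub>G\<^esub> y"
proof
  assume "dd x y = Suc 0"
  then obtain e where "awalk x [e] y" using ddist_walk[of x y] by (auto simp: length_Suc_conv)
  then show "x \<rightarrow>\<^bsub>G\<^esub> y" by (auto simp: awalk_Cons_iff awalk_Nil_iff arcs_ends_conv)
next
  assume xy: "x \<rightarrow>\<^bsub>G\<^esub> y"
  then have "x \<noteq> y" using no_loops by (auto simp: arcs_ends_conv)
  then have "dd x y \<noteq> 0" by simp
  moreover have "dd x x = 0" by simp
  ultimately show "dd x y = Suc 0" using ddist_step[OF xy, of x] by linarith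
qed

lemma ddist_pred:
  assumes "dd x y = Suc m"
  obtains z where "dd x z = m" "z \<rightarrow>\<^bsub>G\<^esub> y"
proof -
  obtain p where p: "awalk x p y" "length p = Suc m" using ddist_walk[of x y] assms by auto
  then obtain q e where qe: "p = q @ [e]" by (metis append_butlast_last_id list.size(3) nat.distinct(1))
  with p have q: "awalk x q (tail G e)" "length q = m" and e: "tail G e \<rightarrow>\<^bsub>G\<^esub> y"
    by (auto simp: awalk_Cons_iff awalk_Nil_iff arcs_ends_conv)
  have "dd x (tail G e) = m"
    using ddist_le[OF q(1)] q(2) ddist_step[OF e, of x] assms by linarith
  with e that show ?thesis by blast
qed

lemma finite_ddist: "finite {dd x y | x y. x \<in> verts G \<and> y \<in> verts G}"
  by (rule finite_image_set2) simp_all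

lemma ddist_le_D: "dd x y \<le> D"
  unfolding diam_def by (rule Max_ge[OF finite_ddist]) (auto simp: verts_UNIV)

text \<open>Descend through predecessors from a pair at distance \<open>D\<close>.\<close>

lemma ddist_surj:
  assumes "i \<le> D"
  shows "\<exists>x y. dd x y = i"
proof -
  have "D \<in> {dd x y | x y. x \<in> verts G \<and> y \<in> verts G}"
    unfolding diam_def by (rule Max_in[OF finite_ddist]) (auto simp: verts_UNIV)
  then obtain x y where xy: "dd x y = D" by auto
  have path: "i \<le> dd x y \<Longrightarrow> \<exists>z. dd x z = i" for y
  proof (induction "dd x y" arbitrary: y)
    case 0
    then show ?case by (metis le_0_eq)
  next
    case (Suc m)
    then obtain z where "dd x z = m" by (metis ddist_pred)
    with Suc show ?case by (metis le_Suc_eq)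
  qed
  from path[of y] xy assms show ?thesis by auto
qed

lemma ddist_image: "(\<lambda>(x, y). dd x y) ` UNIV = {0..D}"
  using ddist_surj ddist_le_D by (fastforce simp: image_iff)

lemma dist_matrix_0: "Ad 0 = mat 1"
  by (simp add: vec_eq_iff dist_nth mat_def)

lemma dist_matrix_1: "Ad (Suc 0) = A"
  by (simp add: vec_eq_iff dist_nth adj_nth ddist_1)

section \<open>Matrices that depend only on the distance\<close>

definition dist_inv :: "complex^'v^'v \<Rightarrow> bool" where
  "dist_inv M \<longleftrightarrow> (\<exists>f. \<forall>x y. M $ x $ y = f (dd x y))"

lemma dist_inv_iff: "dist_inv M \<longleftrightarrow> (\<forall>x y u v. dd x y = dd u v \<longrightarrow> M $ x $ y = M $ u $ v)"
proof
  assume R: "\<forall>x y u v. dd x y = dd u v \<longrightarrow> M $ x $ y = M $ u $ v"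
  \<comment> \<open>A representative pair for each distance; its value at a distance that does not
    occur is irrelevant.\<close>
  define p where "p i = (SOME p. dd (fst p) (snd p) = i)" for i
  have "dd (fst (p (dd x y))) (snd (p (dd x y))) = dd x y" for x y
    unfolding p_def by (rule someI[of _ "(x, y)"]) simp
  with R have "M $ x $ y = M $ fst (p (dd x y)) $ snd (p (dd x y))" for x y by metis
  then show "dist_inv M"
    unfolding dist_inv_def by (intro exI[of _ "\<lambda>i. M $ fst (p i) $ snd (p i)"]) blast
qed (auto simp: dist_inv_def)

lemma dist_inv_Ad: "dist_inv (Ad i)"
  by (auto simp: dist_inv_iff dist_nth)

lemma dist_inv_mat1: "dist_inv (mat 1)"
  using dist_inv_Ad[of 0] by (simp add: dist_matrix_0)

lemma dist_inv_add: "dist_inv M \<Longrightarrow> dist_inv N \<Longrightarrow> dist_inv (M + N)"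
  unfolding dist_inv_iff by (metis vector_add_component)

lemma dist_inv_mscale: "dist_inv M \<Longrightarrow> dist_inv (mscale c M)"
  unfolding dist_inv_iff by (metis mscale_nth)

lemma dist_inv_0: "dist_inv 0"
  by (simp add: dist_inv_iff)

lemma dist_inv_sum: "(\<And>i. i \<in> S \<Longrightarrow> dist_inv (f i)) \<Longrightarrow> dist_inv (\<Sum>i\<in>S. f i)"
  by (induction S rule: infinite_finite_induct) (simp_all add: dist_inv_0 dist_inv_add)

lemma dist_inv_subspace: "cmat.subspace {M. dist_inv M}"
  by (simp add: cmat.subspace_def dist_inv_0 dist_inv_add dist_inv_mscale)

lemma dist_inv_expand:
  assumes "\<And>x y. M $ x $ y = f (dd x y)"
  shows "M = (\<Sum>h=0..D. mscale (f h) (Ad h))"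
  using ddist_le_D by (simp add: vec_eq_iff dist_nth assms if_distrib cong: if_cong)

lemma dist_inv_iff_span: "dist_inv M \<longleftrightarrow> M \<in> cmat.span (Ad ` {0..D})"
proof
  assume "dist_inv M"
  then obtain f where "\<And>x y. M $ x $ y = f (dd x y)" by (auto simp: dist_inv_def)
  from dist_inv_expand[of M f, OF this] show "M \<in> cmat.span (Ad ` {0..D})"
    by (rule ssubst) (intro cmat.span_sum cmat.span_scale cmat.span_base imageI)
next
  assume "M \<in> cmat.span (Ad ` {0..D})"
  moreover have "cmat.span (Ad ` {0..D}) \<subseteq> {M. dist_inv M}"
    by (rule cmat.span_minimal) (auto simp: dist_inv_Ad dist_inv_subspace)
  ultimately show "dist_inv M" by auto
qed

text \<open>The matrices \<open>Ad j\<close> span the distance-invariant ones, so a linear map need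
  only be checked on them.\<close>

lemma dist_inv_linear:
  assumes "\<And>j. j \<le> D \<Longrightarrow> dist_inv (L (Ad j))" "dist_inv M"
    and "\<And>f. L (\<Sum>h=0..D. mscale (f h) (Ad h)) = (\<Sum>h=0..D. mscale (f h) (L (Ad h)))"
  shows "dist_inv (L M)"
proof -
  obtain f where "\<And>x y. M $ x $ y = f (dd x y)" using assms(2) by (auto simp: dist_inv_def)
  from dist_inv_expand[of M f, OF this] have "L M = (\<Sum>h=0..D. mscale (f h) (L (Ad h)))"
    by (simp only: assms(3))
  then show ?thesis using assms(1) by (auto intro!: dist_inv_sum dist_inv_mscale)
qed

lemma dist_inv_mult_right:
  assumes "\<And>j. j \<le> D \<Longrightarrow> dist_inv (Ad j ** N)" "dist_inv M"
  shows "dist_inv (M ** N)"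
  by (rule dist_inv_linear[of "\<lambda>X. X ** N"]) (simp_all add: assms sum_matrix_mult mscale_mult_left)

lemma dist_inv_mult_left:
  assumes "\<And>j. j \<le> D \<Longrightarrow> dist_inv (N ** Ad j)" "dist_inv M"
  shows "dist_inv (N ** M)"
  by (rule dist_inv_linear[of "\<lambda>X. N ** X"]) (simp_all add: assms matrix_mult_sum_right mscale_mult_right)

text \<open>Triangular elimination from the largest distance downwards: a multiple of
  \<open>mpow A i\<close> clears the entries at distance \<open>i\<close> and is already zero beyond
  it.\<close>

lemma dist_inv_in_span_mpow:
  assumes "\<And>k. dist_inv (mpow A k)"
  shows "dist_inv M \<Longrightarrow> (\<And>x y. i \<le> dd x y \<Longrightarrow> M $ x $ y = 0) \<Longrightarrow> M \<in> cmat.span (mpow A ` {..<i})"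
proof (induction i arbitrary: M)
  case 0
  then have "M = 0" by (simp add: vec_eq_iff)
  then show ?case by (simp add: cmat.span_zero)
next
  case (Suc i)
  obtain f g where f: "\<And>x y. M $ x $ y = f (dd x y)" and g: "\<And>x y. mpow A i $ x $ y = g (dd x y)"
    using Suc.prems(1) assms[of i] by (auto simp: dist_inv_def)
  \<comment> \<open>If no pair has distance \<open>i\<close>, then \<open>g i\<close> may be zero
    and the quotient is a default value, which is harmless because there is nothing to
    clear.\<close>
  let ?N = "M - mscale (f i / g i) (mpow A i)"
  have "?N $ x $ y = f (dd x y) - f i / g i * g (dd x y)" for x y by (simp add: f g)
  then have "dist_inv ?N"
    unfolding dist_inv_def by (intro exI[of _ "\<lambda>h. f h - f i / g i * g h"] allI)
  moreover have "?N $ x $ y = 0" if "i \<le> dd x y" for x y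
  proof (cases "dd x y = i")
    case True
    then have "g i \<noteq> 0" using mpow_ddist[of x y] by (auto simp: g)
    with True show ?thesis by (simp add: f g)
  next
    case False
    with that have "Suc i \<le> dd x y" "i < dd x y" by auto
    then show ?thesis using Suc.prems(2)[of x y] by (simp add: mpow_below)
  qed
  ultimately have "?N \<in> cmat.span (mpow A ` {..<i})" by (rule Suc.IH)
  then have "?N \<in> cmat.span (mpow A ` {..<Suc i})"
    by (rule subsetD[OF cmat.span_mono, rotated]) auto
  moreover have "mscale (f i / g i) (mpow A i) \<in> cmat.span (mpow A ` {..<Suc i})"
    by (intro cmat.span_scale cmat.span_base) simp
  ultimately have "?N + mscale (f i / g i) (mpow A i) \<in> cmat.span (mpow A ` {..<Suc i})"
    by (rule cmat.span_add)
  then show ?case by simp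
qed

text \<open>The condition to which each of (i) to (viii) is reduced.\<close>

definition dist_closed :: bool where
  "dist_closed \<longleftrightarrow> (\<forall>k. dist_inv (mpow A k)) \<and> dist_inv (transpose A)"

text \<open>No distance exceeds \<open>D\<close>, so the elimination applies to every
  distance-invariant matrix. Conversely these matrices form a subspace containing all powers of
  \<open>A\<close>.\<close>

lemma dist_closed_polynomial:
  assumes dist_closed
  shows "dist_inv M \<longleftrightarrow> polynomial_in M A"
proof
  assume "dist_inv M"
  moreover have "M $ x $ y = 0" if "Suc D \<le> dd x y" for x y
    using that ddist_le_D[of x y] by simp
  ultimately have "M \<in> cmat.span (mpow A ` {..<Suc D})"
    using assms by (intro dist_inv_in_span_mpow) (auto simp: dist_closed_def)
  then show "polynomial_in M A"
    using cmat.span_mono[of "mpow A ` {..<Suc D}" "range (mpow A)"] by (auto simp: polynomial_in_iff_span)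
next
  assume "polynomial_in M A"
  moreover have "cmat.span (range (mpow A)) \<subseteq> {M. dist_inv M}"
    by (rule cmat.span_minimal) (use assms in \<open>auto simp: dist_inv_subspace dist_closed_def\<close>)
  ultimately show "dist_inv M" by (auto simp: polynomial_in_iff_span)
qed

lemma dist_closed_mult:
  "dist_closed \<Longrightarrow> dist_inv M \<Longrightarrow> dist_inv N \<Longrightarrow> dist_inv (M ** N)"
  by (simp add: dist_closed_polynomial polynomial_in_mult)

lemma dist_closed_commute:
  "dist_closed \<Longrightarrow> dist_inv M \<Longrightarrow> dist_inv N \<Longrightarrow> M ** N = N ** M"
  by (auto simp: dist_closed_polynomial intro: polynomial_in_commute)

text \<open>The transpose of a polynomial in \<open>A\<close> is the same polynomial in the
  transpose of \<open>A\<close>, which is itself a polynomial in \<open>A\<close>.\<close>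

lemma dist_closed_transpose:
  assumes dist_closed "dist_inv M"
  shows "dist_inv (transpose M)"
proof -
  have "polynomial_in (transpose A) A"
    using assms(1) dist_closed_polynomial[OF assms(1)] by (simp add: dist_closed_def)
  moreover have "polynomial_in (transpose M) (transpose A)"
    using assms(2) unfolding dist_closed_polynomial[OF assms(1)] polynomial_in_def
    by (auto simp: mpoly_transpose)
  ultimately show ?thesis
    unfolding dist_closed_polynomial[OF assms(1)] by (rule polynomial_in_trans[rotated])
qed

text \<open>The transposed distance matrix for \<open>dd y x\<close> has entry 1 at
  \<open>(x, y)\<close>, hence also at \<open>(u, v)\<close>.\<close>

lemma dist_closed_reverse:
  assumes dist_closed "dd x y = dd u v"
  shows "dd y x = dd v u"
proof -
  have "dist_inv (transpose (Ad (dd y x)))" using dist_closed_transpose dist_inv_Ad assms by blast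
  then have "transpose (Ad (dd y x)) $ x $ y = transpose (Ad (dd y x)) $ u $ v"
    using assms(2) unfolding dist_inv_iff by blast
  then show ?thesis by (auto simp: transpose_def dist_nth split: if_splits)
qed

lemma dist_closed_from_right:
  assumes "\<And>j. j \<le> D \<Longrightarrow> dist_inv (Ad j ** A)" "dist_inv (transpose A)"
  shows dist_closed
proof -
  have "dist_inv (mpow A k)" for k
    by (induction k) (auto simp: dist_inv_mat1 mpow_Suc2 intro: dist_inv_mult_right assms)
  with assms(2) show ?thesis by (simp add: dist_closed_def)
qed

lemma dist_closed_from_left:
  assumes "\<And>j. j \<le> D \<Longrightarrow> dist_inv (A ** Ad j)" "dist_inv (transpose A)"
  shows dist_closed
proof -
  have "dist_inv (mpow A k)" for k
    by (induction k) (auto simp: dist_inv_mat1 mpow_Suc intro: dist_inv_mult_left assms)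
  with assms(2) show ?thesis by (simp add: dist_closed_def)
qed

lemma dist_closed_A: "dist_closed \<Longrightarrow> dist_inv A" "dist_closed \<Longrightarrow> dist_inv (transpose A)"
  using dist_inv_Ad[of "Suc 0"] by (simp_all add: dist_matrix_1 dist_closed_def)

section \<open>Equitable distance partitions\<close>

lemma count_entry:
  fixes P Q :: "'v \<Rightarrow> bool"
  shows "(\<Sum>z\<in>UNIV. (if P z then 1 else 0) * (if Q z then 1 else 0 :: complex)) =
    of_nat (card ({z. P z} \<inter> {z. Q z}))"
proof -
  have "(\<Sum>z\<in>UNIV. (if P z then 1 else 0) * (if Q z then 1 else 0 :: complex)) =
    (\<Sum>z\<in>UNIV. if P z \<and> Q z then 1 else 0)"
    by (intro sum.cong) auto
  also have "\<dots> = of_nat (card {z. P z \<and> Q z})"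
    unfolding card_eq_sum of_nat_sum by (rule sum.mono_neutral_cong_right) auto
  finally show ?thesis by (simp add: Collect_conj_eq)
qed

lemma sphere_Collect: "out_sphere G j x = {z. dd x z = j}" "in_sphere G j x = {z. dd z x = j}"
  by (auto simp: out_sphere_def in_sphere_def verts_UNIV)

text \<open>Counts for out-spheres come from multiplying \<open>Ad j\<close> on the right, those for
  in-spheres from multiplying on the left with the indices exchanged.\<close>

lemma sphere_counts:
  "(Ad j ** A) $ x $ y = of_nat (card (in_sphere G 1 y \<inter> out_sphere G j x))"
  "(Ad j ** transpose A) $ x $ y = of_nat (card (out_sphere G 1 y \<inter> out_sphere G j x))"
  "(transpose A ** Ad j) $ y $ x = of_nat (card (in_sphere G 1 y \<inter> in_sphere G j x))"
  "(A ** Ad j) $ y $ x = of_nat (card (out_sphere G 1 y \<inter> in_sphere G j x))"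
  by (simp_all add: sphere_Collect matrix_matrix_mult_def transpose_def dist_nth adj_nth
      count_entry ddist_1 Int_commute)

text \<open>Turns the existence of common parameters of the partitions into distance-invariance of
  the matrices that count them.\<close>

lemma dist_inv_counts:
  assumes "\<And>j x y. M j $ x $ y = of_nat (c j x y)"
  shows "(\<exists>g. \<forall>x y. \<forall>j\<le>D. c j x y = g (dd x y) j) \<longleftrightarrow> (\<forall>j\<le>D. dist_inv (M j))"
proof
  assume "\<exists>g. \<forall>x y. \<forall>j\<le>D. c j x y = g (dd x y) j"
  then show "\<forall>j\<le>D. dist_inv (M j)" by (auto simp: dist_inv_iff assms)
next
  assume "\<forall>j\<le>D. dist_inv (M j)"
  then have "\<forall>j. \<exists>f. j \<le> D \<longrightarrow> (\<forall>x y. M j $ x $ y = f (dd x y))" by (auto simp: dist_inv_def)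
  then obtain f where f: "\<And>j x y. j \<le> D \<Longrightarrow> M j $ x $ y = f j (dd x y)" by metis
  \<comment> \<open>Recovers the natural number from the complex entry.\<close>
  have "c j x y = nat \<lfloor>Re (f j (dd x y))\<rfloor>" if "j \<le> D" for j x y
    using f[OF that, of x y] by (simp add: assms flip: f[OF that])
  then show "\<exists>g. \<forall>x y. \<forall>j\<le>D. c j x y = g (dd x y) j"
    by (intro exI[of _ "\<lambda>i j. nat \<lfloor>Re (f j i)\<rfloor>"]) blast
qed

lemma equitable_out_iff:
  "equitable_with G D (\<lambda>i. out_sphere G i x) dout din \<longleftrightarrow>
    (\<forall>y. \<forall>j\<le>D. card (out_sphere G 1 y \<inter> out_sphere G j x) = dout (dd x y) j \<and>
      card (in_sphere G 1 y \<inter> out_sphere G j x) = din (dd x y) j)"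
  using ddist_le_D
  by (auto simp: equitable_with_def sphere_Collect disjoint_family_on_def verts_UNIV)

lemma equitable_in_iff:
  "equitable_with G D (\<lambda>i. in_sphere G i x) dout din \<longleftrightarrow>
    (\<forall>y. \<forall>j\<le>D. card (out_sphere G 1 y \<inter> in_sphere G j x) = dout (dd y x) j \<and>
      card (in_sphere G 1 y \<inter> in_sphere G j x) = din (dd y x) j)"
  using ddist_le_D
  by (auto simp: equitable_with_def sphere_Collect disjoint_family_on_def verts_UNIV)

lemma distance_regular_iff: "distance_regular_digraph G \<longleftrightarrow> dist_closed"
proof -
  have "distance_regular_digraph G \<longleftrightarrow>
    (\<exists>g. \<forall>x y. \<forall>j\<le>D. card (out_sphere G 1 y \<inter> out_sphere G j x) = g (dd x y) j) \<and>
    (\<exists>g. \<forall>x y. \<forall>j\<le>D. card (in_sphere G 1 y \<inter> out_sphere G j x) = g (dd x y) j)"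
    unfolding distance_regular_digraph_def equitable_out_iff verts_UNIV
    by (simp only: ball_UNIV imp_conjR all_conj_distrib ex_simps)
  also have "\<dots> \<longleftrightarrow> (\<forall>j\<le>D. dist_inv (Ad j ** transpose A)) \<and> (\<forall>j\<le>D. dist_inv (Ad j ** A))"
    by (simp only: dist_inv_counts[of "\<lambda>j. Ad j ** transpose A", OF sphere_counts(2)]
        dist_inv_counts[of "\<lambda>j. Ad j ** A", OF sphere_counts(1)])
  also have "\<dots> \<longleftrightarrow> dist_closed"
  proof
    assume *: "(\<forall>j\<le>D. dist_inv (Ad j ** transpose A)) \<and> (\<forall>j\<le>D. dist_inv (Ad j ** A))"
    \<comment> \<open>Since \<open>Ad 0\<close> is the identity, the case of index 0 is
      distance-invariance of the transpose itself.\<close>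
    then have "dist_inv (Ad 0 ** transpose A)" by blast
    with * show dist_closed by (intro dist_closed_from_right) (auto simp: dist_matrix_0)
  qed (auto intro: dist_closed_mult dist_inv_Ad dist_closed_A)
  finally show ?thesis .
qed

lemma in_partition_iff:
  "(\<exists>dout din. \<forall>x. equitable_with G D (\<lambda>i. in_sphere G i x) dout din) \<longleftrightarrow> dist_closed"
proof -
  have "(\<exists>dout din. \<forall>x. equitable_with G D (\<lambda>i. in_sphere G i x) dout din) \<longleftrightarrow>
    (\<exists>g. \<forall>y x. \<forall>j\<le>D. card (out_sphere G 1 y \<inter> in_sphere G j x) = g (dd y x) j) \<and>
    (\<exists>g. \<forall>y x. \<forall>j\<le>D. card (in_sphere G 1 y \<inter> in_sphere G j x) = g (dd y x) j)"
    unfolding equitable_in_iff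
    by (subst all_comm) (simp only: imp_conjR all_conj_distrib ex_simps)
  also have "\<dots> \<longleftrightarrow> (\<forall>j\<le>D. dist_inv (A ** Ad j)) \<and> (\<forall>j\<le>D. dist_inv (transpose A ** Ad j))"
    by (simp only: dist_inv_counts[of "\<lambda>j. A ** Ad j", OF sphere_counts(4)]
        dist_inv_counts[of "\<lambda>j. transpose A ** Ad j", OF sphere_counts(3)])
  also have "\<dots> \<longleftrightarrow> dist_closed"
  proof
    assume *: "(\<forall>j\<le>D. dist_inv (A ** Ad j)) \<and> (\<forall>j\<le>D. dist_inv (transpose A ** Ad j))"
    then have "dist_inv (transpose A ** Ad 0)" by blast
    with * show dist_closed by (intro dist_closed_from_left) (auto simp: dist_matrix_0)
  qed (auto intro: dist_closed_mult dist_inv_Ad dist_closed_A)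
  finally show ?thesis .
qed

end

section \<open>Association schemes\<close>

text \<open>Renaming indices along a bijection. It reduces the scheme indexed by pairs of distances
  to the one indexed by distances.\<close>

lemma comm_assoc_scheme_reindex:
  assumes f: "bij_betw f I' I" and i0: "i0' \<in> I'" "f i0' = i0"
    and R: "\<And>i. i \<in> I' \<Longrightarrow> R' i = R (f i)"
  shows "comm_assoc_scheme d I' i0' R' \<longleftrightarrow> comm_assoc_scheme d I i0 R"
proof -
  have I: "I = f ` I'" and inj: "inj_on f I'" using f by (auto simp: bij_betw_def)
  have im: "R' ` I' = R ` I" "(\<lambda>h. rel_matrix (R' h)) ` I' = (\<lambda>h. rel_matrix (R h)) ` I"
    using R by (auto simp: I image_image)
  have "inj_on R' I' \<longleftrightarrow> inj_on R I"
    unfolding I inj_on_imageI2 using inj R by (auto simp: inj_on_def)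
  moreover have "(\<Sum>i\<in>I'. rel_matrix (R' i)) = (\<Sum>i\<in>I. rel_matrix (R i))"
    unfolding I sum.reindex[OF inj] using R by (auto intro!: sum.cong)
  moreover have "finite I' \<longleftrightarrow> finite I" "card I' = card I"
    using bij_betw_finite[OF f] bij_betw_same_card[OF f] by auto
  moreover have "rel_matrix (R' i0') = rel_matrix (R i0)" "i0' \<in> I' \<longleftrightarrow> i0 \<in> I"
    using R i0 by (auto simp: I)
  moreover have "(\<forall>i\<in>I'. \<exists>j\<in>I'. transpose (rel_matrix (R' i)) = rel_matrix (R' j)) \<longleftrightarrow>
    (\<forall>i\<in>I. \<exists>j\<in>I. transpose (rel_matrix (R i)) = rel_matrix (R j))"
    unfolding I by (simp add: R)
  moreover have "(\<forall>i\<in>I'. \<forall>j\<in>I'. rel_matrix (R' i) ** rel_matrix (R' j) \<in> cmat.span ((\<lambda>h. rel_matrix (R h)) ` f ` I')) \<longleftrightarrow>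
    (\<forall>i\<in>I. \<forall>j\<in>I. rel_matrix (R i) ** rel_matrix (R j) \<in> cmat.span ((\<lambda>h. rel_matrix (R h)) ` f ` I'))"
    unfolding I by (simp add: R)
  moreover have "(\<forall>i\<in>I'. \<forall>j\<in>I'. rel_matrix (R' i) ** rel_matrix (R' j) = rel_matrix (R' j) ** rel_matrix (R' i)) \<longleftrightarrow>
    (\<forall>i\<in>I. \<forall>j\<in>I. rel_matrix (R i) ** rel_matrix (R j) = rel_matrix (R j) ** rel_matrix (R i))"
    unfolding I by (simp add: R)
  ultimately show ?thesis unfolding comm_assoc_scheme_def im by (simp add: I)
qed

context strong_digraph
begin

abbreviation Rd :: "nat \<Rightarrow> ('v \<times> 'v) set" where "Rd i \<equiv> {(x, y). dd x y = i}"

lemma dist_relation_eq: "{(x, y). Ad i $ x $ y = 1} = Rd i"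
  by (auto simp: dist_nth)

lemma rel_matrix_dist: "rel_matrix (Rd i) = Ad i"
  by (simp add: rel_matrix_def dist_matrix_def)

lemma zero_diam: "D = 0 \<Longrightarrow> A = 0"
proof -
  assume "D = 0"
  then have "dd x y \<noteq> Suc 0" for x y using ddist_le_D[of x y] by linarith
  then show ?thesis by (simp add: vec_eq_iff adj_nth ddist_1)
qed

text \<open>Forward and backward distance determine each other, so reversing all pairs at distance
  \<open>i\<close> gives exactly the pairs at one other distance.\<close>

lemma dist_closed_transpose_Ad:
  assumes dist_closed "i \<le> D"
  shows "\<exists>j\<le>D. transpose (Ad i) = Ad j"
proof -
  obtain x y where xy: "dd x y = i" using ddist_surj[OF assms(2)] by blast
  have "dd v u = i \<longleftrightarrow> dd u v = dd y x" for u v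
    using dist_closed_reverse[OF assms(1), of v u x y] dist_closed_reverse[OF assms(1), of u v y x]
    unfolding xy by blast
  then have "transpose (Ad i) = Ad (dd y x)" by (simp add: vec_eq_iff transpose_def dist_nth)
  then show ?thesis using ddist_le_D by blast
qed

lemma dist_closed_scheme:
  assumes dist_closed
  shows "comm_assoc_scheme D {0..D} 0 Rd"
  unfolding comm_assoc_scheme_def rel_matrix_dist
proof (intro conjI ballI)
  show "inj_on Rd {0..D}"
  proof (rule inj_onI)
    fix i j assume "i \<in> {0..D}" "Rd i = Rd j"
    then show "i = j" using ddist_surj[of i] by auto
  qed
  show "partition_on UNIV (Rd ` {0..D})"
    unfolding partition_on_def
  proof (intro conjI notI)
    show "\<Union> (Rd ` {0..D}) = UNIV" using ddist_le_D by auto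
    show "disjoint (Rd ` {0..D})" by (auto simp: disjoint_def)
  next
    assume "{} \<in> Rd ` {0..D}"
    then obtain i where "i \<le> D" "\<forall>x y. dd x y \<noteq> i" by auto
    then show False using ddist_surj[of i] by blast
  qed
  show "(\<Sum>i\<in>{0..D}. Ad i) = (\<chi> x y. 1)"
    using ddist_le_D by (simp add: vec_eq_iff dist_nth)
  show "\<exists>j\<in>{0..D}. transpose (Ad i) = Ad j" if "i \<in> {0..D}" for i
    using dist_closed_transpose_Ad[OF assms, of i] that by auto
  show "Ad i ** Ad j \<in> cmat.span (Ad ` {0..D})" for i j
    using dist_closed_mult[OF assms dist_inv_Ad dist_inv_Ad] by (simp add: dist_inv_iff_span)
  show "Ad i ** Ad j = Ad j ** Ad i" for i j
    by (rule dist_closed_commute[OF assms dist_inv_Ad dist_inv_Ad])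
qed (auto simp: dist_matrix_0)

text \<open>\<open>A\<close> is one of the matrices of the scheme only for positive diameter; for
  \<open>D = 0\<close> it vanishes.\<close>

lemma dist_closed_if_transpose_and_products:
  assumes "D > 0 \<Longrightarrow> dist_inv (transpose A)" "\<And>j. j \<le> D \<Longrightarrow> D > 0 \<Longrightarrow> dist_inv (Ad j ** A)"
  shows dist_closed
proof (rule dist_closed_from_right)
  have "D = 0 \<Longrightarrow> transpose A = 0" by (simp add: zero_diam vec_eq_iff transpose_def)
  with assms(1) show "dist_inv (transpose A)" using dist_inv_0 by (cases "D = 0") auto
  have "D = 0 \<Longrightarrow> Ad j ** A = 0" for j by (simp add: zero_diam vec_eq_iff matrix_matrix_mult_def)
  with assms(2) show "dist_inv (Ad j ** A)" if "j \<le> D" for j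
    using dist_inv_0 that by (cases "D = 0") auto
qed

lemma scheme_iff: "comm_assoc_scheme D {0..D} 0 Rd \<longleftrightarrow> dist_closed"
proof
  assume "comm_assoc_scheme D {0..D} 0 Rd"
  then have tr: "\<forall>i\<in>{0..D}. \<exists>j\<in>{0..D}. transpose (Ad i) = Ad j"
    and mul: "\<forall>i\<in>{0..D}. \<forall>j\<in>{0..D}. dist_inv (Ad i ** Ad j)"
    unfolding comm_assoc_scheme_def rel_matrix_dist dist_inv_iff_span by blast+
  show dist_closed
  proof (rule dist_closed_if_transpose_and_products)
    assume "D > 0"
    then have 1: "Suc 0 \<in> {0..D}" by simp
    with tr obtain j where "transpose (Ad (Suc 0)) = Ad j" by blast
    then show "dist_inv (transpose A)" by (simp add: dist_matrix_1 dist_inv_Ad)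
    show "dist_inv (Ad j ** A)" if "j \<le> D" for j
      using mul 1 that unfolding dist_matrix_1[symmetric] by simp
  qed
qed (rule dist_closed_scheme)

text \<open>For the harder direction, the powers of \<open>A\<close> lie in the Bose-Mesner algebra,
  hence are constant on each relation, and so is the distance. Counting then matches the
  \<open>D + 1\<close> relations with the \<open>D + 1\<close> distances.\<close>

lemma bose_mesner_iff:
  "(\<exists>R :: nat \<Rightarrow> ('v \<times> 'v) set. comm_assoc_scheme D {0..D} 0 R \<and>
      generated_algebra A = bose_mesner_algebra {0..D} R) \<longleftrightarrow> dist_closed"
proof
  assume dist_closed
  then have "generated_algebra A = bose_mesner_algebra {0..D} Rd"
    unfolding generated_algebra_eq bose_mesner_algebra_def rel_matrix_dist
    using dist_closed_polynomial dist_inv_iff_span by blast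
  then show "\<exists>R :: nat \<Rightarrow> ('v \<times> 'v) set. comm_assoc_scheme D {0..D} 0 R \<and>
      generated_algebra A = bose_mesner_algebra {0..D} R"
    using dist_closed_scheme[OF \<open>dist_closed\<close>] by blast
next
  assume "\<exists>R :: nat \<Rightarrow> ('v \<times> 'v) set. comm_assoc_scheme D {0..D} 0 R \<and>
      generated_algebra A = bose_mesner_algebra {0..D} R"
  then obtain R :: "nat \<Rightarrow> ('v \<times> 'v) set" where sch: "comm_assoc_scheme D {0..D} 0 R"
    and gen: "{M. polynomial_in M A} = cmat.span ((\<lambda>i. rel_matrix (R i)) ` {0..D})"
    unfolding generated_algebra_eq bose_mesner_algebra_def by blast
  let ?B = "cmat.span ((\<lambda>i. rel_matrix (R i)) ` {0..D})"
  have part: "partition_on UNIV (R ` {0..D})"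
    and tr: "\<forall>i\<in>{0..D}. \<exists>j\<in>{0..D}. transpose (rel_matrix (R i)) = rel_matrix (R j)"
    and inj: "inj_on R {0..D}"
    using sch[unfolded comm_assoc_scheme_def] by - (elim conjE, assumption)+
  have disj: "i = j" if "p \<in> R i" "p \<in> R j" "i \<le> D" "j \<le> D" for p i j
  proof -
    have "R i = R j" using part that unfolding partition_on_def disjoint_def by (auto 4 4)
    with inj that show ?thesis by (auto simp: inj_on_def)
  qed
  have const: "M $ x $ y = M $ u $ v" if "M \<in> ?B" "(x, y) \<in> R h" "(u, v) \<in> R h" "h \<le> D" for M h x y u v
    using that(1)
  proof (induction rule: cmat.span_induct_alt)
    case base
    show ?case by simp
  next
    case (step c X Y)
    then obtain i where i: "i \<le> D" "X = rel_matrix (R i)" by auto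
    have "(x, y) \<in> R i \<longleftrightarrow> (u, v) \<in> R i" using disj that i(1) by blast
    with i step show ?case by (simp add: rel_matrix_def)
  qed
  have pow: "mpow A k \<in> ?B" for k
    using gen polynomial_in_mpow[of A k] by blast
  have dconst: "dd x y = dd u v" if "(x, y) \<in> R h" "(u, v) \<in> R h" "h \<le> D" for x y u v h
    using const[OF pow that] by (rule ddist_cong)
  have cls: "\<exists>h\<le>D. p \<in> R h" for p
  proof -
    have "p \<in> \<Union> (R ` {0..D})" unfolding partition_onD1[OF part, symmetric] by simp
    then show ?thesis by auto
  qed
  have "\<exists>p. h \<le> D \<longrightarrow> p \<in> R h" for h
  proof -
    have "R h \<noteq> {}" if "h \<le> D"
      using partition_onD3[OF part] that by (metis atLeastAtMost_iff image_eqI zero_le)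
    then show ?thesis by blast
  qed
  then obtain p where p: "\<And>h. h \<le> D \<Longrightarrow> p h \<in> R h" by metis
  \<comment> \<open>The common distance of all pairs in the relation \<open>R h\<close>.\<close>
  define \<delta> where "\<delta> h = dd (fst (p h)) (snd (p h))" for h
  have \<delta>: "dd x y = \<delta> h" if "(x, y) \<in> R h" "h \<le> D" for x y h
    unfolding \<delta>_def by (rule dconst[OF that(1) _ that(2)]) (simp add: p that(2))
  have "\<delta> ` {0..D} = {0..D}"
  proof (intro equalityI subsetI)
    fix i assume "i \<in> {0..D}"
    then obtain x y where "dd x y = i" using ddist_surj[of i] by auto
    moreover obtain h where "h \<le> D" "(x, y) \<in> R h" using cls by blast
    ultimately show "i \<in> \<delta> ` {0..D}" using \<delta> by (auto intro!: image_eqI[of _ _ h])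
  qed (use ddist_le_D in \<open>auto simp: \<delta>_def\<close>)
  \<comment> \<open>A map of a finite set onto a set of equal size is injective, so each distance
    belongs to a single relation.\<close>
  then have inj\<delta>: "inj_on \<delta> {0..D}"
    by (intro eq_card_imp_inj_on) simp_all
  have inv: "dist_inv M" if "M \<in> ?B" for M
    unfolding dist_inv_iff
  proof (intro allI impI)
    fix x y u v assume eq: "dd x y = dd u v"
    obtain h h' where h: "h \<le> D" "(x, y) \<in> R h" "h' \<le> D" "(u, v) \<in> R h'" using cls by blast
    then have "\<delta> h = \<delta> h'" using \<delta> eq by metis
    with h have "h = h'" using inj\<delta> by (auto simp: inj_on_def)
    with h const[OF that] show "M $ x $ y = M $ u $ v" by blast
  qed
  have trB: "transpose M \<in> ?B" if "M \<in> ?B" for M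
    using that
  proof (induction rule: cmat.span_induct_alt)
    case base
    have "transpose 0 = (0 :: complex^'v^'v)" by (simp add: vec_eq_iff transpose_def)
    then show ?case by (simp add: cmat.span_zero)
  next
    case (step c X Y)
    then obtain i where i: "i \<le> D" "X = rel_matrix (R i)" by auto
    have "i \<in> {0..D}" using i by simp
    with tr i(2) obtain j where "j \<le> D" "transpose X = rel_matrix (R j)"
      unfolding Ball_def Bex_def atLeastAtMost_iff by blast
    then have "transpose X \<in> ?B" by (auto intro: cmat.span_base)
    with step show ?case by (simp add: transpose_add transpose_mscale cmat.span_add cmat.span_scale)
  qed
  show dist_closed
    unfolding dist_closed_def using inv[OF pow] inv[OF trB[OF pow[of "Suc 0"]]] by simp
qed

lemma distance_algebra_iff:
  "transpose A \<in> {Ad 0, Ad 1} \<union> Ad ` {2..D} \<and>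
    (\<exists>p :: nat \<Rightarrow> nat \<Rightarrow> complex. \<forall>i\<in>{0..D}. Ad i ** A = (\<Sum>h=0..D. mscale (p h i) (Ad h)))
   \<longleftrightarrow> dist_closed"
proof
  assume *: "transpose A \<in> {Ad 0, Ad 1} \<union> Ad ` {2..D} \<and>
    (\<exists>p :: nat \<Rightarrow> nat \<Rightarrow> complex. \<forall>i\<in>{0..D}. Ad i ** A = (\<Sum>h=0..D. mscale (p h i) (Ad h)))"
  then obtain p :: "nat \<Rightarrow> nat \<Rightarrow> complex"
    where p: "\<And>i. i \<le> D \<Longrightarrow> Ad i ** A = (\<Sum>h=0..D. mscale (p h i) (Ad h))" by auto
  have "dist_inv (Ad i ** A)" if "i \<le> D" for i
    unfolding p[OF that] by (intro dist_inv_sum dist_inv_mscale dist_inv_Ad)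
  moreover have "dist_inv (transpose A)" using * dist_inv_Ad by auto
  ultimately show dist_closed by (rule dist_closed_from_right)
next
  assume c: dist_closed
  have "transpose A \<in> {Ad 0, Ad 1} \<union> Ad ` {2..D}"
  \<comment> \<open>For the one-vertex digraph the transpose is the zero matrix, which is
    \<open>Ad 1\<close> although 1 exceeds \<open>D\<close>.\<close>
  proof (cases "D = 0")
    case True
    then have "transpose A = A" by (simp add: zero_diam vec_eq_iff transpose_def)
    then show ?thesis by (simp add: dist_matrix_1)
  next
    case False
    then obtain j where j: "j \<le> D" "transpose A = Ad j"
      using dist_closed_transpose_Ad[OF c, of "Suc 0"] by (auto simp: dist_matrix_1)
    consider "j = 0" | "j = 1" | "2 \<le> j" by linarith
    then show ?thesis using j by cases auto
  qed
  moreover have "\<forall>i. \<exists>f. Ad i ** A = (\<Sum>h=0..D. mscale (f h) (Ad h))"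
  proof
    fix i
    have "dist_inv (Ad i ** A)" using c by (intro dist_closed_mult dist_inv_Ad dist_closed_A)
    then obtain f where "\<And>x y. (Ad i ** A) $ x $ y = f (dd x y)" by (auto simp: dist_inv_def)
    from dist_inv_expand[of _ f, OF this] show "\<exists>f. Ad i ** A = (\<Sum>h=0..D. mscale (f h) (Ad h))" by blast
  qed
  then obtain f where "\<And>i. Ad i ** A = (\<Sum>h=0..D. mscale (f i h) (Ad h))" by metis
  then have "\<exists>p :: nat \<Rightarrow> nat \<Rightarrow> complex. \<forall>i\<in>{0..D}. Ad i ** A = (\<Sum>h=0..D. mscale (p h i) (Ad h))"
    by (intro exI[of _ "\<lambda>h i. f i h"]) blast
  ultimately show "transpose A \<in> {Ad 0, Ad 1} \<union> Ad ` {2..D} \<and>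
    (\<exists>p :: nat \<Rightarrow> nat \<Rightarrow> complex. \<forall>i\<in>{0..D}. Ad i ** A = (\<Sum>h=0..D. mscale (p h i) (Ad h)))" ..
qed

text \<open>The first projection maps \<open>\<Delta>\<close> onto the distances \<open>0\<close> to
  \<open>D\<close>. It is injective in one direction because a \<open>D\<close>-class scheme has
  \<open>D + 1\<close> indices, in the other by \<open>dist_closed_reverse\<close>; the two schemes
  then coincide up to renaming.\<close>

lemma two_way_scheme_iff:
  assumes "\<Delta> = {(dd x y, dd y x) | x y. True}"
  shows "comm_assoc_scheme D \<Delta> (0, 0) (\<lambda>i. {(x, y). (dd x y, dd y x) = i}) \<longleftrightarrow> dist_closed"
proof -
  have fst_img: "fst ` \<Delta> = {0..D}"
  proof -
    have "\<Delta> = (\<lambda>(x, y). (dd x y, dd y x)) ` UNIV" by (auto simp: assms)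
    then show ?thesis by (simp add: image_image case_prod_beta flip: ddist_image)
  qed
  have iff: "comm_assoc_scheme D \<Delta> (0, 0) (\<lambda>i. {(x, y). (dd x y, dd y x) = i}) \<longleftrightarrow>
      comm_assoc_scheme D {0..D} 0 Rd" if inj: "inj_on fst \<Delta>"
  proof (rule comm_assoc_scheme_reindex[of fst])
    show "bij_betw fst \<Delta> {0..D}" using inj fst_img by (simp add: bij_betw_def)
    show "(0, 0) \<in> \<Delta>" unfolding assms by (auto intro!: exI[of _ undefined])
    show "{(x, y). (dd x y, dd y x) = i} = Rd (fst i)" if "i \<in> \<Delta>" for i
    proof -
      have "(dd x y, dd y x) = i" if "dd x y = fst i" for x y
      proof (rule inj_onD[OF inj _ _ \<open>i \<in> \<Delta>\<close>])
        show "(dd x y, dd y x) \<in> \<Delta>" unfolding assms by blast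
      qed (simp add: that)
      then have "(dd x y, dd y x) = i \<longleftrightarrow> dd x y = fst i" for x y by (metis fst_conv)
      then show ?thesis by (simp only:)
    qed
  qed simp
  show ?thesis
  proof
    assume sch: "comm_assoc_scheme D \<Delta> (0, 0) (\<lambda>i. {(x, y). (dd x y, dd y x) = i})"
    then have "finite \<Delta>" "card \<Delta> = D + 1" by (auto simp: comm_assoc_scheme_def)
    then have "inj_on fst \<Delta>" by (intro eq_card_imp_inj_on) (simp_all add: fst_img)
    with sch iff show dist_closed by (simp add: scheme_iff)
  next
    assume c: dist_closed
    have "inj_on fst \<Delta>"
    proof (rule inj_onI)
      fix i j assume "i \<in> \<Delta>" "j \<in> \<Delta>" and eq: "fst i = fst j"
      then obtain x y u v where "i = (dd x y, dd y x)" "j = (dd u v, dd v u)" unfolding assms by blast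
      with eq dist_closed_reverse[OF c, of x y u v] show "i = j" by simp
    qed
    with c iff show "comm_assoc_scheme D \<Delta> (0, 0) (\<lambda>i. {(x, y). (dd x y, dd y x) = i})"
      by (simp add: scheme_iff)
  qed
qed

end

section \<open>Spectral characterizations\<close>

text \<open>The weighted sum of the squares of the differences of \<open>f\<close> along the arcs vanishes.\<close>

lemma harmonic_equal_neighbours:
  fixes a :: "'v::finite \<Rightarrow> 'v \<Rightarrow> real" and f :: "'v \<Rightarrow> complex"
  assumes nonneg: "\<And>x y. a x y \<ge> 0" and row: "\<And>x. (\<Sum>y\<in>UNIV. a x y) = k"
    and col: "\<And>y. (\<Sum>x\<in>UNIV. a x y) = k"
    and harm: "\<And>x. (\<Sum>y\<in>UNIV. a x y *\<^sub>R f y) = k *\<^sub>R f x"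
    and pos: "a x y > 0"
  shows "f x = f y"
proof -
  have "(\<Sum>x\<in>UNIV. \<Sum>y\<in>UNIV. a x y * (norm (f x - f y))\<^sup>2) =
      (\<Sum>x\<in>UNIV. \<Sum>y\<in>UNIV. a x y * (f x \<bullet> f x)) + (\<Sum>x\<in>UNIV. \<Sum>y\<in>UNIV. a x y * (f y \<bullet> f y))
      - 2 * (\<Sum>x\<in>UNIV. \<Sum>y\<in>UNIV. a x y * (f x \<bullet> f y))"
    unfolding sum_distrib_left sum.distrib[symmetric] sum_subtractf[symmetric]
    by (intro sum.cong refl)
      (simp add: power2_norm_eq_inner inner_diff_left inner_diff_right inner_commute algebra_simps)
  also have "(\<Sum>x\<in>UNIV. \<Sum>y\<in>UNIV. a x y * (f x \<bullet> f x)) = (\<Sum>x\<in>UNIV. k * (f x \<bullet> f x))"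
    by (simp add: sum_distrib_right[symmetric] row)
  also have "(\<Sum>x\<in>UNIV. \<Sum>y\<in>UNIV. a x y * (f y \<bullet> f y)) = (\<Sum>y\<in>UNIV. k * (f y \<bullet> f y))"
    by (subst sum.swap) (simp add: sum_distrib_right[symmetric] col)
  also have "(\<Sum>x\<in>UNIV. \<Sum>y\<in>UNIV. a x y * (f x \<bullet> f y)) = (\<Sum>x\<in>UNIV. f x \<bullet> (\<Sum>y\<in>UNIV. a x y *\<^sub>R f y))"
    by (simp add: inner_sum_right)
  also have "\<dots> = (\<Sum>x\<in>UNIV. k * (f x \<bullet> f x))"
    by (simp only: harm inner_scaleR_right)
  finally have "(\<Sum>x\<in>UNIV. \<Sum>y\<in>UNIV. a x y * (norm (f x - f y))\<^sup>2) = 0" by simp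
  then have "\<forall>x\<in>UNIV. (\<Sum>y\<in>UNIV. a x y * (norm (f x - f y))\<^sup>2) = 0"
    by (subst (asm) sum_nonneg_eq_0_iff) (auto intro!: sum_nonneg simp: nonneg)
  then have "(\<Sum>y\<in>UNIV. a x y * (norm (f x - f y))\<^sup>2) = 0" by blast
  then have "\<forall>y\<in>UNIV. a x y * (norm (f x - f y))\<^sup>2 = 0"
    by (subst (asm) sum_nonneg_eq_0_iff) (auto simp: nonneg)
  then have "a x y * (norm (f x - f y))\<^sup>2 = 0" by blast
  with pos show ?thesis by simp
qed

context strong_digraph
begin

abbreviation J :: "complex^'v^'v" where "J \<equiv> \<chi> x y. 1"

lemma dist_inv_J: "dist_inv J"
  by (simp add: dist_inv_iff)

lemma adjm_A: "adjm A = transpose A"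
  by (simp add: vec_eq_iff transpose_def adj_nth)

lemma normal_A: "polynomial_in (transpose A) A \<Longrightarrow> A ** adjm A = adjm A ** A"
  unfolding adjm_A by (rule polynomial_in_commute[OF polynomial_in_self])

section \<open>Regularity and the number of eigenvalues\<close>

lemma out_degree_eq: "(\<Sum>y\<in>UNIV. A $ x $ y) = of_nat (out_degree G x)"
proof -
  have "(\<Sum>y\<in>UNIV. A $ x $ y) = of_nat (card {y. x \<rightarrow>\<^bsub>G\<^esub> y})"
    unfolding card_eq_sum of_nat_sum by (rule sum.mono_neutral_cong_right) (auto simp: adj_nth)
  also have "{y. x \<rightarrow>\<^bsub>G\<^esub> y} = head G ` out_arcs G x"
    by (auto simp: arcs_ends_conv out_arcs_def)
  also have "card \<dots> = out_degree G x"
    unfolding out_degree_def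
    by (rule card_image) (auto simp: inj_on_def out_arcs_def arc_to_ends_def intro: no_multi_arcs)
  finally show ?thesis .
qed

lemma in_degree_eq: "(\<Sum>x\<in>UNIV. A $ x $ y) = of_nat (in_degree G y)"
proof -
  have "(\<Sum>x\<in>UNIV. A $ x $ y) = of_nat (card {x. x \<rightarrow>\<^bsub>G\<^esub> y})"
    unfolding card_eq_sum of_nat_sum by (rule sum.mono_neutral_cong_right) (auto simp: adj_nth)
  also have "{x. x \<rightarrow>\<^bsub>G\<^esub> y} = tail G ` in_arcs G y"
    by (auto simp: arcs_ends_conv in_arcs_def)
  also have "card \<dots> = in_degree G y"
    unfolding in_degree_def
    by (rule card_image) (auto simp: inj_on_def in_arcs_def arc_to_ends_def intro: no_multi_arcs)
  finally show ?thesis .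
qed

text \<open>The all-ones matrix is distance-invariant, so it commutes with \<open>A\<close>;
  comparing entries equates every out-degree with every in-degree.\<close>

lemma dist_closed_regular:
  assumes dist_closed
  shows "\<exists>k. regular_digraph G k"
proof -
  have "A ** J = J ** A"
    using assms by (intro dist_closed_commute dist_inv_J dist_closed_A)
  then have "(A ** J) $ x $ y = (J ** A) $ x $ y" for x y by simp
  then have "of_nat (out_degree G x) = (of_nat (in_degree G y) :: complex)" for x y
    by (simp add: matrix_matrix_mult_def out_degree_eq in_degree_eq)
  then have "out_degree G x = in_degree G y" for x y by (simp only: of_nat_eq_iff)
  then have "regular_digraph G (in_degree G undefined)"
    unfolding regular_digraph_def by metis
  then show ?thesis by blast
qed

text \<open>Otherwise some pair has distance equal to the number of eigenvalues. At this pair only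
  the leading term of the annihilating polynomial contributes, and it is nonzero.\<close>

lemma diam_less_card_eigenvalues:
  assumes "polynomial_in (transpose A) A"
  shows "D < card (eigenvalues A)"
proof (rule ccontr)
  note normal = normal_A[OF assms]
  let ?q = "annihilator (eigenvalues A)" and ?n = "card (eigenvalues A)"
  have fin: "finite (eigenvalues A)" by (rule normal_trace_product(3)[OF normal])
  assume "\<not> D < ?n"
  then obtain x y where xy: "dd x y = ?n" using ddist_surj[of ?n] by auto
  have "mpoly ?q A $ x $ y = (\<Sum>i\<le>?n. coeff ?q i * mpow A i $ x $ y)"
    by (subst mpoly_altdef[of _ ?n]) (simp_all add: degree_annihilator fin)
  also have "\<dots> = (\<Sum>i\<in>{?n}. coeff ?q i * mpow A i $ x $ y)"
    by (rule sum.mono_neutral_right) (auto simp: xy intro!: mpow_below)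
  also have "\<dots> \<noteq> 0" using mpow_ddist[of x y] by (simp add: xy coeff_annihilator fin)
  finally show False by (simp add: normal_annihilator[OF normal])
qed

text \<open>The power \<open>D + 1\<close> of \<open>A\<close> is a combination of lower powers, so
  all eigenvalues are roots of one polynomial of degree at most \<open>D + 1\<close>. The previous
  bound gives the other inequality.\<close>

lemma dist_closed_card_eigenvalues:
  assumes dist_closed
  shows "card (eigenvalues A) = D + 1"
proof -
  have tr: "polynomial_in (transpose A) A"
    using assms dist_closed_polynomial[OF assms] dist_closed_A by blast
  have "mpow A (Suc D) $ x $ y = 0" if "Suc D \<le> dd x y" for x y
    using that ddist_le_D[of x y] by simp
  then have "mpow A (Suc D) \<in> cmat.span (mpow A ` {..<Suc D})"
    using assms by (intro dist_inv_in_span_mpow) (auto simp: dist_closed_def)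
  then obtain p where p: "mpow A (Suc D) = mpoly p A" "\<And>i. i \<notin> {..<Suc D} \<Longrightarrow> coeff p i = 0"
    using that by (rule span_mpow_obtain) blast
  let ?r = "monom 1 (Suc D) + smult (- 1) p"
  have r0: "mpoly ?r A = 0"
    using p(1) by (simp only: mpoly_add mpoly_smult mpoly_monom) (simp add: vec_eq_iff)
  have "coeff ?r (Suc D) = 1" using p(2)[of "Suc D"] by simp
  then have r: "?r \<noteq> 0" by (metis coeff_0 zero_neq_one)
  have "degree ?r \<le> Suc D"
    by (rule degree_le) (use p(2) in auto)
  moreover have "card (eigenvalues A) \<le> card {z. poly ?r z = 0}"
    using eigenvalue_root[OF _ r0] by (intro card_mono[OF poly_roots_finite[OF r]] subsetI CollectI)
  moreover have "card {z. poly ?r z = 0} \<le> degree ?r"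
    using r by (rule card_poly_roots_bound)
  ultimately show ?thesis using diam_less_card_eigenvalues[OF tr] by linarith
qed

section \<open>Real polynomials in the adjacency matrix and orthogonality\<close>

lemma adj_inner:
  fixes M N :: "complex^'v^'v"
  shows "(M ** transpose A) \<bullet> N = M \<bullet> (N ** A)"
  by (simp only: Re_trace_adjm[symmetric] adjm_mult adjm_A matrix_mul_assoc)

abbreviation realA :: "(complex^'v^'v) set" where "realA \<equiv> span (range (mpow A))"

lemma subspace_cspan: "subspace (cmat.span S)"
  by (auto simp: subspace_def cmat.span_zero cmat.span_add scaleR_matrix cmat.span_scale)

lemma span_mpow_complex: "M \<in> span (mpow A ` S) \<Longrightarrow> M \<in> cmat.span (mpow A ` S)"
  using span_minimal[OF cmat.span_superset subspace_cspan] by blast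

lemma span_mpow_real: "M \<in> span (mpow A ` S) \<Longrightarrow> Im (M $ x $ y) = 0"
proof (induction rule: span_induct_alt)
  case (step c X Y)
  then show ?case using mpow_real(1)[of _ x y] by (auto simp: scaleR_matrix) (metis Im_complex_of_real)
qed simp

text \<open>The powers of \<open>A\<close> are real, so taking real parts of all entries replaces
  each coefficient by its real part.\<close>

lemma span_mpow_if_real:
  assumes "M \<in> cmat.span (mpow A ` S)" "\<And>x y. Im (M $ x $ y) = 0"
  shows "M \<in> span (mpow A ` S)"
proof -
  let ?R = "\<lambda>M :: complex^'v^'v. (\<chi> x y. of_real (Re (M $ x $ y))) :: complex^'v^'v"
  have "?R M \<in> span (mpow A ` S)"
    using assms(1)
  proof (induction rule: cmat.span_induct_alt)
    case base
    have "?R 0 = 0" by (simp add: vec_eq_iff)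
    then show ?case by (simp only: span_zero)
  next
    case (step c X Y)
    then obtain i where i: "i \<in> S" "X = mpow A i" by auto
    have "Im (mpow A i $ x $ y) = 0" for x y by (metis Im_complex_of_real mpow_real(1))
    then have "?R (mscale c X + Y) = Re c *\<^sub>R X + ?R Y"
      by (simp add: vec_eq_iff i scaleR_matrix complex_eq_iff)
    with step i show ?case by (simp add: span_add span_scale span_base)
  qed
  moreover have "?R M = M" by (simp add: vec_eq_iff complex_eq_iff assms(2))
  ultimately show ?thesis by simp
qed

lemma realA_iff: "M \<in> realA \<longleftrightarrow> polynomial_in M A \<and> (\<forall>x y. Im (M $ x $ y) = 0)"
  using span_mpow_complex[of M UNIV] span_mpow_real[of M UNIV] span_mpow_if_real[of M UNIV]
  by (auto simp: polynomial_in_iff_span)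

lemma realA_mult: "M \<in> realA \<Longrightarrow> N \<in> realA \<Longrightarrow> M ** N \<in> realA"
proof -
  assume M: "M \<in> realA" "N \<in> realA"
  then have "Im ((M ** N) $ x $ y) = 0" for x y by (simp add: realA_iff matrix_matrix_mult_def)
  with M show ?thesis by (simp add: realA_iff polynomial_in_mult)
qed

lemma Ad_inner: "Ad i \<bullet> M = (\<Sum>x\<in>UNIV. \<Sum>y\<in>UNIV. if dd x y = i then Re (M $ x $ y) else 0)"
  by (auto simp: inner_vec_def dist_nth inner_complex_eq intro!: sum.cong)

lemma Ad_orthogonal: "l < i \<Longrightarrow> Ad i \<bullet> mpow A l = 0"
  by (auto simp: Ad_inner mpow_below intro!: sum.neutral)

text \<open>The inner product is a sum of nonnegative terms, so its vanishing would make
  \<open>mpow A i\<close> zero at every pair at distance \<open>i\<close>.\<close>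

lemma Ad_inner_mpow: "i \<le> D \<Longrightarrow> Ad i \<bullet> mpow A i \<noteq> 0"
proof
  assume "i \<le> D" and 0: "Ad i \<bullet> mpow A i = 0"
  then obtain x y where xy: "dd x y = i" using ddist_surj by blast
  let ?s = "\<lambda>x y. if dd x y = i then Re (mpow A i $ x $ y) else 0"
  have "\<forall>x\<in>UNIV. (\<Sum>y\<in>UNIV. ?s x y) = 0"
    using 0 unfolding Ad_inner by (subst (asm) sum_nonneg_eq_0_iff) (auto intro!: sum_nonneg simp: mpow_real(2))
  then have "(\<Sum>y\<in>UNIV. ?s x y) = 0" by blast
  then have "\<forall>y\<in>UNIV. ?s x y = 0"
    by (subst (asm) sum_nonneg_eq_0_iff) (auto simp: mpow_real(2))
  then have "?s x y = 0" by blast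
  then have "Re (mpow A i $ x $ y) = 0" using xy by simp
  then have "mpow A i $ x $ y = 0" using mpow_real(1)[of i x y] by simp
  with mpow_ddist[of x y] xy show False by simp
qed

lemma span_low_zero: "S \<in> span (mpow A ` {..<i}) \<Longrightarrow> i \<le> dd x y \<Longrightarrow> S $ x $ y = 0"
  by (induction rule: span_induct_alt) (auto simp: mpow_below scaleR_matrix)

text \<open>Membership in the orthogonal complement, inside \<open>realA\<close>, of the first
  \<open>i\<close> powers of \<open>A\<close>.\<close>

definition orth_below :: "nat \<Rightarrow> complex^'v^'v \<Rightarrow> bool" where
  "orth_below i M \<longleftrightarrow> M \<in> realA \<and> (\<forall>l<i. M \<bullet> mpow A l = 0)"

lemma orth_decomposition:
  assumes "M \<in> realA"
  obtains S T where "M = S + T" "S \<in> span (mpow A ` {..<i})" "orth_below i T"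
    "\<And>W. W \<in> span (mpow A ` {..<i}) \<Longrightarrow> T \<bullet> W = 0"
proof -
  obtain S T where ST: "S \<in> span (mpow A ` {..<i})" "M = S + T"
    "\<And>W. W \<in> span (mpow A ` {..<i}) \<Longrightarrow> orthogonal T W"
    using orthogonal_subspace_decomp_exists[of "mpow A ` {..<i}" M] by metis
  have "S \<in> realA" using ST(1) span_mono[of "mpow A ` {..<i}" "range (mpow A)"] by blast
  with assms have "M - S \<in> realA" by (rule span_diff)
  then have "T \<in> realA" using ST(2) by simp
  with ST have "orth_below i T"
    by (auto simp: orth_below_def orthogonal_def intro: span_base)
  with ST that show ?thesis by (auto simp: orthogonal_def)
qed

text \<open>The Gram-Schmidt remainder of \<open>mpow A i\<close> is nonzero: the lower powers
  vanish at distance \<open>i\<close>, whereas \<open>mpow A i\<close> does not.\<close>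

lemma orth_below_witness:
  assumes "i \<le> D"
  obtains N where "orth_below i N" "N \<bullet> mpow A i \<noteq> 0"
proof -
  have "mpow A i \<in> realA" by (simp add: span_base)
  then obtain S T where ST: "mpow A i = S + T" "S \<in> span (mpow A ` {..<i})" "orth_below i T"
    "\<And>W. W \<in> span (mpow A ` {..<i}) \<Longrightarrow> T \<bullet> W = 0"
    by (rule orth_decomposition[of _ i]) (use that in blast)
  obtain x y where xy: "dd x y = i" using ddist_surj[OF assms] by blast
  have "T \<noteq> 0"
  proof
    assume "T = 0"
    then have "mpow A i $ x $ y = 0" using span_low_zero[OF ST(2)] ST(1) xy by simp
    with mpow_ddist[of x y] xy show False by simp
  qed
  moreover have "T \<bullet> mpow A i = T \<bullet> T" using ST(4)[OF ST(2)] by (simp add: ST(1) inner_add_right)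
  ultimately show ?thesis using that[OF ST(3)] by simp
qed

text \<open>One elimination step: modulo a single matrix \<open>N\<close>, an element of level
  \<open>i\<close> moves to level \<open>Suc i\<close>. This drives the descending
  inductions.\<close>

lemma orth_below_reduce:
  assumes "orth_below i M" "orth_below i N" "N \<bullet> mpow A i \<noteq> 0"
  shows "orth_below (Suc i) (M - ((M \<bullet> mpow A i) / (N \<bullet> mpow A i)) *\<^sub>R N)"
  using assms by (auto simp: orth_below_def inner_diff_left less_Suc_eq span_diff span_scale)

end

section \<open>Regular digraphs of spectrally maximum diameter\<close>

text \<open>The hypotheses shared by (vii) and (viii).\<close>

locale spectrally_max_digraph = strong_digraph G for G :: "('v::finite, 'e) pre_digraph" +
  fixes k :: nat
  assumes regular: "regular_digraph G k"
    and transpose_poly: "polynomial_in (transpose A) A"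
    and max_diam: "card (eigenvalues A) = D + 1"
begin

lemmas normal = normal_A[OF transpose_poly]
lemmas finite_ev = normal_trace_product(3)[OF normal]

lemma row_sum: "(\<Sum>y\<in>UNIV. A $ x $ y) = of_nat k" and col_sum: "(\<Sum>x\<in>UNIV. A $ x $ y) = of_nat k"
  using regular by (simp_all add: out_degree_eq in_degree_eq regular_digraph_def verts_UNIV)

lemma valency_eigenvalue: "of_nat k \<in> eigenvalues A"
proof -
  have "A *v (\<chi> i. 1) = of_nat k *s (\<chi> i. 1)"
    by (simp add: vec_eq_iff matrix_vector_mult_def row_sum)
  moreover have "(\<chi> i. 1) \<noteq> (0 :: complex^'v)" by (simp add: vec_eq_iff)
  ultimately show ?thesis unfolding eigenvalues_def by blast
qed

lemma eig_pi_nonzero: "eig_pi A c \<noteq> 0"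
  unfolding eig_pi_def by (subst prod_zero_iff) (auto simp: finite_ev)

lemma poly_annihilator_minus:
  assumes "c' \<in> eigenvalues A"
  shows "poly (annihilator (eigenvalues A - {c})) c' = (if c' = c then eig_pi A c else 0)"
  using assms finite_ev by (auto simp: poly_annihilator eig_pi_def intro!: prod_zero)

lemma equal_on_arcs_imp_constant:
  assumes "\<And>x y. x \<rightarrow>\<^bsub>G\<^esub> y \<Longrightarrow> f x = f y"
  shows "f x = f y"
proof (induction "dd x y" arbitrary: y)
  case 0
  then show ?case by (metis ddist_0)
next
  case (Suc m)
  then obtain z where "dd x z = m" "z \<rightarrow>\<^bsub>G\<^esub> y" by (metis ddist_pred)
  with Suc assms show ?case by metis
qed

lemma Re_sums: "(\<Sum>y\<in>UNIV. Re (A $ x $ y)) = real k" "(\<Sum>x\<in>UNIV. Re (A $ x $ y)) = real k"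
  using arg_cong[OF row_sum[of x], of Re] arg_cong[OF col_sum[of y], of Re] by simp_all

text \<open>\<open>E\<close> is a multiple of the projection onto the eigenspace of the valency. Its
  columns and rows are harmonic for the arc weights, hence constant along arcs and, by strong
  connectivity, everywhere. Applying \<open>E\<close> to the all-ones vector determines the
  constant.\<close>

lemma valency_idempotent:
  defines "E \<equiv> mpoly (annihilator (eigenvalues A - {of_nat k})) A"
  obtains c where "\<And>x y. E $ x $ y = c" "of_nat CARD('v) * c = eig_pi A (of_nat k)"
proof -
  let ?q = "annihilator (eigenvalues A - {of_nat k})"
  have ann: "annihilator (eigenvalues A) = [:- of_nat k, 1:] * ?q"
    unfolding annihilator_def using finite_ev valency_eigenvalue by (subst prod.remove[of _ "of_nat k"]) auto
  have "mpoly [:- of_nat k, 1:] A ** E = 0"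
    by (simp only: E_def mpoly_mult[symmetric] ann[symmetric] normal_annihilator[OF normal])
  then have AE: "A ** E = mscale (of_nat k) E" by (simp add: mpoly_linear)
  have "polynomial_in E A" unfolding E_def polynomial_in_def by blast
  then have EA: "E ** A = mscale (of_nat k) E"
    using polynomial_in_commute[OF _ polynomial_in_self] AE by metis
  have re: "of_real (Re (A $ x $ y)) = A $ x $ y" for x y by (simp add: adj_nth)
  have 1: "E $ x $ z = E $ y $ z" for x y z
  proof (rule equal_on_arcs_imp_constant)
    fix x y assume xy: "x \<rightarrow>\<^bsub>G\<^esub> y"
    show "E $ x $ z = E $ y $ z"
    proof (rule harmonic_equal_neighbours[of "\<lambda>x y. Re (A $ x $ y)" "real k" "\<lambda>x. E $ x $ z"])
      show "(\<Sum>y\<in>UNIV. Re (A $ x $ y) *\<^sub>R E $ y $ z) = real k *\<^sub>R E $ x $ z" for x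
        using AE by (simp add: re vec_eq_iff matrix_matrix_mult_def scaleR_conv_of_real)
    qed (use xy in \<open>simp_all add: Re_sums\<close>, simp_all add: adj_nth)
  qed
  have 2: "E $ z $ x = E $ z $ y" for x y z
  proof (rule equal_on_arcs_imp_constant)
    fix x y assume xy: "x \<rightarrow>\<^bsub>G\<^esub> y"
    have "E $ z $ y = E $ z $ x"
    \<comment> \<open>The same argument for rows, with the weights transposed.\<close>
    proof (rule harmonic_equal_neighbours[of "\<lambda>x y. Re (A $ y $ x)" "real k" "\<lambda>x. E $ z $ x"])
      show "(\<Sum>y\<in>UNIV. Re (A $ y $ x) *\<^sub>R E $ z $ y) = real k *\<^sub>R E $ z $ x" for x
        using EA by (simp add: re vec_eq_iff matrix_matrix_mult_def scaleR_conv_of_real mult.commute)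
    qed (use xy in \<open>simp_all add: Re_sums\<close>, simp_all add: adj_nth)
    then show "E $ z $ x = E $ z $ y" ..
  qed
  define c where "c = E $ undefined $ undefined"
  have c: "E $ x $ y = c" for x y unfolding c_def using 1[of x y undefined] 2[of undefined y undefined] by (rule trans)
  have "A *v (\<chi> i. 1) = of_nat k *s (\<chi> i. 1)"
    by (simp add: vec_eq_iff matrix_vector_mult_def row_sum)
  then have "E *v (\<chi> i. 1) = poly ?q (of_nat k) *s (\<chi> i. 1)"
    unfolding E_def by (rule mpoly_eigenvector)
  then have "of_nat CARD('v) * c = eig_pi A (of_nat k)"
    using poly_annihilator_minus[OF valency_eigenvalue, of "of_nat k"]
    by (simp add: vec_eq_iff matrix_vector_mult_def c)
  with c that show ?thesis by blast
qed

text \<open>This is the Hoffman polynomial: the constant matrix of \<open>valency_idempotent\<close>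
  is nonzero and can be rescaled.\<close>

lemma J_realA: "J \<in> realA"
proof -
  obtain c where c: "\<And>x y. mpoly (annihilator (eigenvalues A - {of_nat k})) A $ x $ y = c"
    "of_nat CARD('v) * c = eig_pi A (of_nat k)" by (rule valency_idempotent) (use that in blast)
  have "c \<noteq> 0" using c(2) eig_pi_nonzero[of "of_nat k"] by auto
  then have "J = mscale (1 / c) (mpoly (annihilator (eigenvalues A - {of_nat k})) A)"
    by (simp add: vec_eq_iff c(1))
  then have "polynomial_in J A"
    by (metis mpoly_smult polynomial_in_def)
  then show ?thesis by (simp add: realA_iff)
qed

text \<open>The trace of the constant matrix of \<open>valency_idempotent\<close> is computed twice,
  from its entries and from the spectrum.\<close>

lemma valency_mult: "eig_mult A (of_nat k) = 1"
proof -
  let ?q = "annihilator (eigenvalues A - {of_nat k})"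
  obtain c where c: "\<And>x y. mpoly ?q A $ x $ y = c"
    "of_nat CARD('v) * c = eig_pi A (of_nat k)" by (rule valency_idempotent) (use that in blast)
  have "adjm (mat 1) = (mat 1 :: complex^'v^'v)" by (simp add: vec_eq_iff mat_def)
  then have "trace (mpoly ?q A) = trace (mpoly ?q A ** adjm (mpoly 1 A))" by simp
  also have "\<dots> = (\<Sum>c\<in>eigenvalues A. of_nat (eig_mult A c) * (poly ?q c * cnj (poly 1 c)))"
    by (rule normal_trace_product(1)[OF normal])
  also have "\<dots> = (\<Sum>c\<in>eigenvalues A.
      if c = of_nat k then of_nat (eig_mult A (of_nat k)) * eig_pi A (of_nat k) else 0)"
    by (intro sum.cong) (auto simp: poly_annihilator_minus)
  also have "\<dots> = of_nat (eig_mult A (of_nat k)) * eig_pi A (of_nat k)"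
    using finite_ev valency_eigenvalue by simp
  finally have "of_nat (eig_mult A (of_nat k)) * eig_pi A (of_nat k) = eig_pi A (of_nat k)"
    using c by (simp add: trace_def)
  then have "of_nat (eig_mult A (of_nat k)) = (1 :: complex)" using eig_pi_nonzero by simp
  then show ?thesis by (simp only: of_nat_eq_1_iff)
qed

lemma transpose_realA: "transpose A \<in> realA"
  by (simp add: realA_iff transpose_poly) (simp add: transpose_def adj_nth)

text \<open>The annihilating polynomial is monic of degree \<open>D + 1\<close>, so it expresses the
  power \<open>D + 1\<close> through lower ones.\<close>

lemma realA_eq: "realA = span (mpow A ` {..D})"
proof (rule antisym)
  let ?q = "annihilator (eigenvalues A)"
  have deg: "degree ?q = Suc D" "coeff ?q (Suc D) = 1"
    using degree_annihilator[OF finite_ev] coeff_annihilator[OF finite_ev] max_diam by simp_all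
  have "0 = (\<Sum>i\<le>Suc D. mscale (coeff ?q i) (mpow A i))"
    using mpoly_altdef[of ?q "Suc D" A] deg normal_annihilator[OF normal] by simp
  also have "\<dots> = (\<Sum>i\<le>D. mscale (coeff ?q i) (mpow A i)) + mpow A (Suc D)"
    by (simp add: deg(2))
  finally have "mpow A (Suc D) = - (\<Sum>i\<le>D. mscale (coeff ?q i) (mpow A i))"
    by (metis add.commute add_eq_0_iff)
  then have "mpow A (Suc D) \<in> cmat.span (mpow A ` {..D})"
    by (rule ssubst) (intro cmat.span_neg cmat.span_sum cmat.span_scale cmat.span_base imageI)
  then have next_pow: "mpow A (Suc D) \<in> span (mpow A ` {..D})"
    by (rule span_mpow_if_real) (metis Im_complex_of_real mpow_real(1))
  have step: "A ** M \<in> span (mpow A ` {..D})" if "M \<in> span (mpow A ` {..D})" for M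
    using that
  proof (induction rule: span_induct_alt)
    case base
    have "A ** (0 :: complex^'v^'v) = 0" by (simp add: vec_eq_iff matrix_matrix_mult_def)
    then show ?case by (simp only: span_zero)
  next
    case (step c X Y)
    then obtain i where i: "i \<le> D" "X = mpow A i" by auto
    have "A ** X \<in> span (mpow A ` {..D})"
      using i next_pow by (cases "i = D") (auto simp: mpow_Suc[symmetric] intro!: span_base)
    with step show ?case
      by (simp add: scaleR_matrix matrix_add_ldistrib mscale_mult_right)
        (simp add: scaleR_matrix[symmetric] span_add span_scale)
  qed
  have "mpow A i \<in> span (mpow A ` {..D})" for i
  proof (induction i)
    case 0
    show ?case by (intro span_base imageI) simp
  qed (auto simp: mpow_Suc intro: step)
  then show "realA \<subseteq> span (mpow A ` {..D})" by (intro span_minimal) auto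
qed (rule span_mono, auto)

lemma orth_below_all: "orth_below (Suc D) M \<Longrightarrow> M = 0"
proof -
  assume M: "orth_below (Suc D) M"
  then have "M \<in> span (mpow A ` {..D})" by (simp add: orth_below_def realA_eq[symmetric])
  moreover have "orthogonal M y" if "y \<in> mpow A ` {..D}" for y
    using M that by (auto simp: orth_below_def orthogonal_def)
  ultimately have "orthogonal M M" by (metis orthogonal_to_span orthogonal_commute)
  then show ?thesis by (simp add: orthogonal_def)
qed

lemma orth_below_Ad: "Ad i \<in> realA \<Longrightarrow> orth_below i (Ad i)"
  by (simp add: orth_below_def Ad_orthogonal)

text \<open>Subtracting a multiple of \<open>Ad D\<close> moves \<open>M\<close> to level
  \<open>Suc D\<close>, where only zero remains.\<close>

lemma orth_below_D:
  assumes "Ad D \<in> realA" "orth_below D M"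
  obtains t where "M = t *\<^sub>R Ad D"
  using orth_below_all[OF orth_below_reduce[OF assms(2) orth_below_Ad[OF assms(1)] Ad_inner_mpow]]
  by simp

text \<open>
  Multiplication by \<open>transpose A\<close> is adjoint to multiplication by \<open>A\<close> and lowers the distances
  on which a matrix is supported by at most one.
\<close>

lemma orth_below_support:
  assumes AD: "Ad D \<in> realA" and "i \<le> D"
  shows "orth_below i M \<Longrightarrow> dd x y < i \<Longrightarrow> M $ x $ y = 0"
  using assms(2)
proof (induction arbitrary: M x y rule: inc_induct)
  case base
  from orth_below_D[OF AD base(1)] obtain t where "M = t *\<^sub>R Ad D" .
  with base(2) show ?case by (simp add: scaleR_matrix dist_nth)
next
  case (step j)
  then have "Suc j \<le> D" by simp
  then obtain N where N: "orth_below (Suc j) N" "N \<bullet> mpow A (Suc j) \<noteq> 0"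
    by (rule orth_below_witness)
  let ?N = "N ** transpose A"
  have "?N \<in> realA" using N(1) by (auto simp: orth_below_def intro: realA_mult transpose_realA)
  moreover have "?N \<bullet> mpow A l = N \<bullet> mpow A (Suc l)" for l
    by (simp add: adj_inner mpow_Suc2)
  ultimately have N': "orth_below j ?N" "?N \<bullet> mpow A j \<noteq> 0"
    using N by (auto simp: orth_below_def)
  \<comment> \<open>The entry sums \<open>N\<close> over pairs \<open>(x, z)\<close> with
    \<open>z\<close> an out-neighbour of \<open>y\<close>. Their distances are at most
    \<open>j\<close>, where \<open>N\<close> vanishes by the induction hypothesis.\<close>
  have suppN: "?N $ x $ y = 0"
  proof -
    have "N $ x $ z = 0" if "y \<rightarrow>\<^bsub>G\<^esub> z" for z
      using ddist_step[OF that, of x] step.prems(2) by (intro step.IH[OF N(1)]) linarith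
    then show ?thesis by (auto simp: matrix_matrix_mult_def transpose_def adj_nth intro!: sum.neutral)
  qed
  have "(M - ((M \<bullet> mpow A j) / (?N \<bullet> mpow A j)) *\<^sub>R ?N) $ x $ y = 0"
    by (rule step.IH[OF orth_below_reduce[OF step.prems(1) N']]) (use step.prems(2) in simp)
  with suppN show ?case by (simp add: scaleR_matrix)
qed

lemma Ad_D_realA_imp_dist_closed:
  assumes AD: "Ad D \<in> realA"
  shows dist_closed
proof -
  let ?B = "\<lambda>i. (\<chi> x y. if dd x y < i then 1 else 0) :: complex^'v^'v"
  have B: "?B i \<in> realA" if "i \<le> Suc D" for i
  proof (cases "i = Suc D")
    case True
    then have "?B i = J" using ddist_le_D by (auto simp: vec_eq_iff less_Suc_eq_le)
    then show ?thesis using J_realA by simp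
  next
    case False
    with that have iD: "i \<le> D" by simp
    \<comment> \<open>\<open>S\<close> vanishes at distances from \<open>i\<close> on and
      \<open>T\<close> below \<open>i\<close>, so the equation \<open>J = S + T\<close> determines
      \<open>S\<close> completely.\<close>
    from J_realA obtain S T where ST: "J = S + T" "S \<in> span (mpow A ` {..<i})" "orth_below i T"
      by (rule orth_decomposition[of _ i]) (use that in blast)
    have e: "S $ x $ y + T $ x $ y = 1" for x y
      using arg_cong[OF ST(1), of "\<lambda>M. M $ x $ y"] by simp
    have "S $ x $ y = ?B i $ x $ y" for x y
      using e[of x y] orth_below_support[OF AD iD ST(3), of x y] span_low_zero[OF ST(2), of x y]
      by (cases "dd x y < i") auto
    then have "S = ?B i" by (simp add: vec_eq_iff)
    then show ?thesis
      using ST(2) span_mono[of "mpow A ` {..<i}" "range (mpow A)"] by blast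
  qed
  have Ad: "Ad i \<in> realA" if "i \<le> D" for i
  proof -
    have "Ad i = ?B (Suc i) - ?B i" by (auto simp: vec_eq_iff dist_nth)
    then show ?thesis using B[of i] B[of "Suc i"] that by (simp only: span_diff)
  qed
  \<comment> \<open>Now that all distance matrices lie in \<open>realA\<close>, descending induction
    peels off a multiple of \<open>Ad i\<close> at each level; level 0 is the whole of
    \<open>realA\<close>.\<close>
  have inv: "dist_inv M" if "orth_below i M" "i \<le> Suc D" for i M
    using that(2,1)
  proof (induction arbitrary: M rule: inc_induct)
    case base
    then show ?case using orth_below_all dist_inv_0 by metis
  next
    case (step i)
    then have i: "i \<le> D" by simp
    let ?t = "(M \<bullet> mpow A i) / (Ad i \<bullet> mpow A i)"
    have "dist_inv (M - ?t *\<^sub>R Ad i)"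
      using step.IH[OF orth_below_reduce[OF step.prems orth_below_Ad[OF Ad[OF i]] Ad_inner_mpow[OF i]]] .
    then have "dist_inv ((M - ?t *\<^sub>R Ad i) + ?t *\<^sub>R Ad i)"
      unfolding scaleR_matrix by (intro dist_inv_add dist_inv_mscale dist_inv_Ad)
    then show ?case by simp
  qed
  have "dist_inv M" if "M \<in> realA" for M
    by (rule inv[of 0]) (simp_all add: orth_below_def that)
  then show ?thesis
    unfolding dist_closed_def using transpose_realA by (auto intro: span_base)
qed

lemma polynomial_Ad_D_iff: "polynomial_in (Ad D) A \<longleftrightarrow> Ad D \<in> realA"
  by (simp add: realA_iff dist_nth)

section \<open>The spectral excess\<close>

text \<open>\<open>T\<close> is the component of \<open>J\<close> orthogonal to the powers of \<open>A\<close> below \<open>D\<close>; it is the value of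
  the predistance polynomial of degree \<open>D\<close>.\<close>

lemma top_component:
  obtains T where "orth_below D T" "\<And>x y. dd x y = D \<Longrightarrow> T $ x $ y = 1" "T \<bullet> T = T \<bullet> J"
proof -
  from J_realA obtain S T where ST: "J = S + T" "S \<in> span (mpow A ` {..<D})" "orth_below D T"
    "\<And>W. W \<in> span (mpow A ` {..<D}) \<Longrightarrow> T \<bullet> W = 0"
    by (rule orth_decomposition[of _ D]) (use that in blast)
  have "T $ x $ y = 1" if "dd x y = D" for x y
    using arg_cong[OF ST(1), of "\<lambda>M. M $ x $ y"] span_low_zero[OF ST(2), of x y] that by simp
  moreover have "T \<bullet> T = T \<bullet> J"
    using ST(4)[OF ST(2)] unfolding ST(1) by (simp add: inner_add_right)
  ultimately show ?thesis using that ST(3) by blast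
qed

text \<open>The trace of \<open>T\<close> against the monic polynomial vanishing at all eigenvalues
  except \<open>c\<close> is computed twice: orthogonality leaves only the leading power, and the
  spectral formula leaves only \<open>c\<close>. The common value is independent of
  \<open>c\<close>.\<close>

lemma top_component_spectrum:
  assumes T: "orth_below D T" "T = mpoly p A" and c: "c \<in> eigenvalues A"
  shows "of_nat (eig_mult A c) * (poly p c * cnj (eig_pi A c)) = of_real (T \<bullet> mpow A D)"
proof -
  let ?q = "annihilator (eigenvalues A - {c})"
  have card: "card (eigenvalues A - {c}) = D" using c finite_ev max_diam by simp
  have deg: "degree ?q = D" "coeff ?q D = 1"
    using degree_annihilator[of "eigenvalues A - {c}"] coeff_annihilator[of "eigenvalues A - {c}"]
      finite_ev card by simp_all
  have Treal: "Im (T $ x $ y) = 0" for x y using T(1) by (simp add: orth_below_def realA_iff)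
  have Areal: "Im (mpow A i $ x $ y) = 0" for i x y by (metis Im_complex_of_real mpow_real(1))
  have "adjm (mpoly ?q A) = (\<Sum>i\<le>D. mscale (cnj (coeff ?q i)) (adjm (mpow A i)))"
    using mpoly_altdef[of ?q D A] deg by (simp add: vec_eq_iff)
  then have "trace (T ** adjm (mpoly ?q A)) =
      (\<Sum>i\<le>D. trace (mscale (cnj (coeff ?q i)) (T ** adjm (mpow A i))))"
    by (simp add: matrix_mult_sum_right mscale_mult_right trace_def) (rule sum.swap)
  also have "\<dots> = (\<Sum>i\<le>D. cnj (coeff ?q i) * trace (T ** adjm (mpow A i)))"
    by (simp add: trace_def sum_distrib_left)
  also have "\<dots> = (\<Sum>i\<le>D. cnj (coeff ?q i) * of_real (T \<bullet> mpow A i))"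
    by (simp add: trace_adjm_real[OF Treal Areal])
  also have "\<dots> = (\<Sum>i\<in>{D}. cnj (coeff ?q i) * of_real (T \<bullet> mpow A i))"
    by (rule sum.mono_neutral_right) (use T(1) in \<open>auto simp: orth_below_def\<close>)
  finally have 1: "trace (T ** adjm (mpoly ?q A)) = of_real (T \<bullet> mpow A D)" by (simp add: deg)
  have "trace (T ** adjm (mpoly ?q A)) =
      (\<Sum>c'\<in>eigenvalues A. of_nat (eig_mult A c') * (poly p c' * cnj (poly ?q c')))"
    unfolding T(2) by (rule normal_trace_product(1)[OF normal])
  also have "\<dots> = (\<Sum>c'\<in>eigenvalues A.
      if c' = c then of_nat (eig_mult A c) * (poly p c * cnj (eig_pi A c)) else 0)"
    by (intro sum.cong) (auto simp: poly_annihilator_minus)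
  also have "\<dots> = of_nat (eig_mult A c) * (poly p c * cnj (eig_pi A c))"
    using c finite_ev by simp
  finally show ?thesis using 1 by simp
qed

definition spectral_sum :: real where
  "spectral_sum = (\<Sum>c\<in>eigenvalues A.
     (cmod (eig_pi A (of_nat k)))\<^sup>2 / (real (eig_mult A c) * (cmod (eig_pi A c))\<^sup>2))"

text \<open>By \<open>top_component_spectrum\<close> the moduli of the values of \<open>p\<close> on
  the spectrum are known up to the constant \<open>w\<close>, which expresses the squared norm
  \<open>b\<close> through \<open>w\<close>. The equation \<open>b = T \<bullet> J\<close> and the
  simple eigenvalue \<open>k\<close> give a second relation, and \<open>w\<close> is
  eliminated.\<close>

lemma top_component_norm:
  assumes T: "orth_below D T" "\<And>x y. dd x y = D \<Longrightarrow> T $ x $ y = 1" "T \<bullet> T = T \<bullet> J"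
  shows "(T \<bullet> T) * spectral_sum = (real CARD('v))\<^sup>2" "T \<bullet> T > 0"
proof -
  let ?n = "real CARD('v)" and ?m = "\<lambda>c. real (eig_mult A c)" and ?\<pi> = "\<lambda>c. cmod (eig_pi A c)"
  define b where "b = T \<bullet> T"
  obtain x y where "dd x y = D" using ddist_surj by blast
  then have "T \<noteq> 0" using T(2)[of x y] by auto
  then have bpos: "b > 0" by (simp add: b_def)
  then show "T \<bullet> T > 0" by (simp add: b_def)
  have Treal: "Im (T $ x $ y) = 0" for x y using T(1) by (simp add: orth_below_def realA_iff)
  obtain p where p: "T = mpoly p A"
    using T(1) by (auto simp: orth_below_def realA_iff polynomial_in_def)
  define w where "w = T \<bullet> mpow A D"
  have spec: "of_nat (eig_mult A c) * (poly p c * cnj (eig_pi A c)) = of_real w" if "c \<in> eigenvalues A" for c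
    unfolding w_def by (rule top_component_spectrum[OF T(1) p that])
  have spec_norm: "?m c * cmod (poly p c) * ?\<pi> c = \<bar>w\<bar>" if "c \<in> eigenvalues A" for c
    using arg_cong[OF spec[OF that], of cmod] by (simp add: norm_mult)
  have summand: "?m c * (cmod (poly p c))\<^sup>2 = w\<^sup>2 / (?m c * (?\<pi> c)\<^sup>2)" if "c \<in> eigenvalues A" for c
  proof -
    have "?m c > 0" using normal_trace_product(2)[OF normal that] by simp
    moreover have "?\<pi> c > 0" using eig_pi_nonzero by simp
    moreover have "w\<^sup>2 = (?m c * cmod (poly p c) * ?\<pi> c)\<^sup>2" unfolding spec_norm[OF that] by simp
    ultimately show ?thesis by (simp add: field_simps power2_eq_square)
  qed
  have "complex_of_real b = trace (T ** adjm T)"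
    unfolding b_def by (rule trace_adjm_real[symmetric]) (rule Treal)+
  also have "\<dots> = (\<Sum>c\<in>eigenvalues A. of_nat (eig_mult A c) * (poly p c * cnj (poly p c)))"
    unfolding p by (rule normal_trace_product(1)[OF normal])
  also have "\<dots> = of_real (\<Sum>c\<in>eigenvalues A. ?m c * (cmod (poly p c))\<^sup>2)"
    by (simp add: complex_norm_square[symmetric])
  finally have "b = (\<Sum>c\<in>eigenvalues A. ?m c * (cmod (poly p c))\<^sup>2)"
    by (simp only: of_real_eq_iff)
  also have "\<dots> = (\<Sum>c\<in>eigenvalues A. w\<^sup>2 / (?m c * (?\<pi> c)\<^sup>2))"
    by (intro sum.cong refl summand)
  finally have b1: "b = (\<Sum>c\<in>eigenvalues A. w\<^sup>2 / (?m c * (?\<pi> c)\<^sup>2))" .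
  have "A *v (\<chi> i. 1) = of_nat k *s (\<chi> i. 1)"
    by (simp add: vec_eq_iff matrix_vector_mult_def row_sum)
  then have "T *v (\<chi> i. 1) = poly p (of_nat k) *s (\<chi> i. 1)"
    unfolding p by (rule mpoly_eigenvector)
  then have rows: "(\<Sum>y\<in>UNIV. T $ x $ y) = poly p (of_nat k)" for x
    by (simp add: vec_eq_iff matrix_vector_mult_def)
  have "Im (poly p (of_nat k)) = 0" unfolding rows[of undefined, symmetric] by (simp add: Treal)
  then have pk: "cmod (poly p (of_nat k)) = \<bar>Re (poly p (of_nat k))\<bar>" by (simp add: cmod_def)
  have "T \<bullet> J = Re (\<Sum>x\<in>UNIV. \<Sum>y\<in>UNIV. T $ x $ y)"
    by (simp add: inner_vec_def inner_complex_eq)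
  then have "b = ?n * Re (poly p (of_nat k))" by (simp add: rows b_def T(3))
  then have "b\<^sup>2 = ?n\<^sup>2 * (cmod (poly p (of_nat k)))\<^sup>2" by (simp add: pk power_mult_distrib)
  moreover have "w\<^sup>2 = (cmod (poly p (of_nat k)))\<^sup>2 * (?\<pi> (of_nat k))\<^sup>2"
    using arg_cong[OF spec_norm[OF valency_eigenvalue], of "\<lambda>x. x\<^sup>2"]
    by (simp add: valency_mult power_mult_distrib)
  \<comment> \<open>Eliminates the value of \<open>p\<close> at the valency.\<close>
  ultimately have nw: "?n\<^sup>2 * w\<^sup>2 = b\<^sup>2 * (?\<pi> (of_nat k))\<^sup>2" by simp
  have "?n\<^sup>2 * b = (\<Sum>c\<in>eigenvalues A. ?n\<^sup>2 * w\<^sup>2 / (?m c * (?\<pi> c)\<^sup>2))"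
    by (subst b1) (simp add: sum_distrib_left)
  also have "\<dots> = b\<^sup>2 * spectral_sum"
    by (simp add: nw spectral_sum_def sum_distrib_left)
  finally have "?n\<^sup>2 * b = b\<^sup>2 * spectral_sum" .
  then show "(T \<bullet> T) * spectral_sum = ?n\<^sup>2"
    using bpos by (simp add: power2_eq_square b_def[symmetric])
qed

text \<open>\<open>T\<close> is 1 wherever \<open>Ad D\<close> is, so the inner products of
  \<open>Ad D\<close> with itself and with \<open>T\<close> both equal the total size of the last
  spheres.\<close>

lemma spectral_excess:
  "polynomial_in (Ad D) A \<longleftrightarrow>
    1 / real CARD('v) * (\<Sum>x\<in>UNIV. real (card (out_sphere G D x))) =
      real CARD('v) * inverse spectral_sum"
proof -
  let ?n = "real CARD('v)"
  obtain T where T: "orth_below D T" "\<And>x y. dd x y = D \<Longrightarrow> T $ x $ y = 1" "T \<bullet> T = T \<bullet> J"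
    by (rule top_component) (use that in blast)
  have count: "(\<Sum>y\<in>UNIV. if dd x y = D then 1 else 0) = real (card (out_sphere G D x))" for x
    by (simp add: sphere_Collect sum.If_cases)
  define a where "a = (\<Sum>x\<in>UNIV. real (card (out_sphere G D x)))"
  have a1: "Ad D \<bullet> Ad D = a"
    unfolding Ad_inner a_def count[symmetric] by (intro sum.cong refl) (simp add: dist_nth)
  have a2: "Ad D \<bullet> T = a"
    unfolding Ad_inner a_def count[symmetric] by (intro sum.cong refl) (simp add: T(2))
  have "polynomial_in (Ad D) A \<longleftrightarrow> a = T \<bullet> T"
  proof
    assume "polynomial_in (Ad D) A"
    then have AD: "Ad D \<in> realA" by (simp add: polynomial_Ad_D_iff)
    obtain t where t: "T = t *\<^sub>R Ad D" by (rule orth_below_D[OF AD T(1)])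
    obtain x y where "dd x y = D" using ddist_surj by blast
    with t T(2)[of x y] have "t = 1" by (simp add: scaleR_matrix dist_nth)
    with t a1 show "a = T \<bullet> T" by simp
  next
    assume "a = T \<bullet> T"
    \<comment> \<open>The squared distance from \<open>Ad D\<close> to \<open>T\<close> is the
      difference between the squared norm of \<open>T\<close> and \<open>a\<close>.\<close>
    then have "(Ad D - T) \<bullet> (Ad D - T) = 0"
      using a1 a2 by (simp add: inner_diff_left inner_diff_right inner_commute)
    then have "Ad D = T" by simp
    then show "polynomial_in (Ad D) A"
      unfolding polynomial_Ad_D_iff using T(1) by (simp add: orth_below_def)
  qed
  also have "\<dots> \<longleftrightarrow> 1 / ?n * a = ?n * inverse spectral_sum"
  proof -
    have n: "?n > 0" by simp
    have nz: "spectral_sum \<noteq> 0" using top_component_norm(1)[OF T] n by auto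
    with n have "1 / ?n * a = ?n * inverse spectral_sum \<longleftrightarrow> a * spectral_sum = ?n\<^sup>2"
      by (simp add: field_simps power2_eq_square)
    also have "\<dots> \<longleftrightarrow> a = T \<bullet> T" using nz by (simp add: top_component_norm(1)[OF T, symmetric])
    finally show ?thesis by simp
  qed
  finally show ?thesis by (simp add: a_def)
qed

end

section \<open>The spectral conditions and the full equivalence\<close>

context strong_digraph
begin

lemma spectral_iff:
  assumes "card (eigenvalues A) = d + 1"
  shows "(\<exists>k. regular_digraph G k) \<and> D = d \<and> polynomial_in (transpose A) A \<and> polynomial_in (Ad D) A
    \<longleftrightarrow> dist_closed"
proof
  assume *: "(\<exists>k. regular_digraph G k) \<and> D = d \<and> polynomial_in (transpose A) A \<and> polynomial_in (Ad D) A"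
  then obtain k where "regular_digraph G k" by blast
  then interpret spectrally_max_digraph G k
    using * assms by unfold_locales simp_all
  show dist_closed using * Ad_D_realA_imp_dist_closed polynomial_Ad_D_iff by blast
next
  assume c: dist_closed
  have "D = d" using dist_closed_card_eigenvalues[OF c] assms by simp
  moreover have "polynomial_in (transpose A) A" "polynomial_in (Ad D) A"
    using dist_closed_A(2)[OF c] dist_inv_Ad[of D] dist_closed_polynomial[OF c] by simp_all
  ultimately show "(\<exists>k. regular_digraph G k) \<and> D = d \<and> polynomial_in (transpose A) A \<and> polynomial_in (Ad D) A"
    using dist_closed_regular[OF c] by blast
qed

text \<open>Under the remaining conditions, for each valency \<open>k\<close>, the numerical
  equation says that \<open>Ad D\<close> is a polynomial in \<open>A\<close>, which reduces (viii)
  to (vii).\<close>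

lemma spectral_excess_iff:
  assumes "card (eigenvalues A) = d + 1"
  shows "(\<exists>k. regular_digraph G k \<and> D = d \<and> polynomial_in (transpose A) A \<and>
      1 / real CARD('v) * (\<Sum>x\<in>UNIV. real (card (out_sphere G D x))) =
      real CARD('v) * inverse (\<Sum>c\<in>eigenvalues A.
        (cmod (eig_pi A (of_nat k)))\<^sup>2 / (real (eig_mult A c) * (cmod (eig_pi A c))\<^sup>2)))
    \<longleftrightarrow> dist_closed"
proof -
  have "1 / real CARD('v) * (\<Sum>x\<in>UNIV. real (card (out_sphere G D x))) =
      real CARD('v) * inverse (\<Sum>c\<in>eigenvalues A.
        (cmod (eig_pi A (of_nat k)))\<^sup>2 / (real (eig_mult A c) * (cmod (eig_pi A c))\<^sup>2))
      \<longleftrightarrow> polynomial_in (Ad D) A"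
    if "regular_digraph G k" "D = d" "polynomial_in (transpose A) A" for k
  proof -
    interpret spectrally_max_digraph G k
      using that assms by unfold_locales simp_all
    show ?thesis using spectral_excess unfolding spectral_sum_def by blast
  qed
  then show ?thesis unfolding spectral_iff[OF assms, symmetric] by blast
qed

end

theorem theorem1p2:
  fixes G :: "('v::finite, 'e) pre_digraph" and d :: nat
  defines "A \<equiv> adj_matrix G"
    and "Ad \<equiv> dist_matrix G"
    and "D \<equiv> diam G"
    and "\<Delta> \<equiv> {(ddist G x y, ddist G y x) | x y. True}"
  assumes "digraph G" and "verts G = UNIV" and "strongly_connected G"
    and "card (eigenvalues A) = d + 1"
  shows
    \<comment> \<open>(i) iff (ii)\<close>
    "(distance_regular_digraph G \<longleftrightarrow>
        (\<exists>dout din. \<forall>x. equitable_with G D (\<lambda>i. in_sphere G i x) dout din)) \<and>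
    \<comment> \<open>(i) iff (iii)\<close>
     (distance_regular_digraph G \<longleftrightarrow>
        comm_assoc_scheme D {0..D} 0 (\<lambda>i. {(x, y). Ad i $ x $ y = 1})) \<and>
    \<comment> \<open>(i) iff (iv)\<close>
     (distance_regular_digraph G \<longleftrightarrow>
        (\<exists>R :: nat \<Rightarrow> ('v \<times> 'v) set. comm_assoc_scheme D {0..D} 0 R \<and>
           generated_algebra A = bose_mesner_algebra {0..D} R)) \<and>
    \<comment> \<open>(i) iff (v); the list \<open>A\<^sub>0, A\<^sub>1, A\<^sub>2, \<dots>, A\<^sub>D\<close> contains \<open>A\<^sub>1 = A\<close> also for
        the one-vertex digraph, where \<open>D = 0\<close>\<close>
     (distance_regular_digraph G \<longleftrightarrow>
        transpose A \<in> {Ad 0, Ad 1} \<union> Ad ` {2..D} \<and>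
        (\<exists>p :: nat \<Rightarrow> nat \<Rightarrow> complex. \<forall>i\<in>{0..D}.
           Ad i ** A = (\<Sum>h=0..D. mscale (p h i) (Ad h)))) \<and>
    \<comment> \<open>(i) iff (vi)\<close>
     (distance_regular_digraph G \<longleftrightarrow>
        comm_assoc_scheme D \<Delta> (0, 0) (\<lambda>i. {(x, y). (ddist G x y, ddist G y x) = i})) \<and>
    \<comment> \<open>(i) iff (vii)\<close>
     (distance_regular_digraph G \<longleftrightarrow>
        (\<exists>k. regular_digraph G k) \<and> D = d \<and>
        polynomial_in (transpose A) A \<and> polynomial_in (Ad D) A) \<and>
    \<comment> \<open>(i) iff (viii); \<open>\<lambda>\<^sub>0\<close> is the valency \<open>k\<close>\<close>
     (distance_regular_digraph G \<longleftrightarrow>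
        (\<exists>k. regular_digraph G k \<and> D = d \<and> polynomial_in (transpose A) A \<and>
           1 / real CARD('v) * (\<Sum>x\<in>UNIV. real (card (out_sphere G D x))) =
           real CARD('v) * inverse (\<Sum>c\<in>eigenvalues A.
             (cmod (eig_pi A (of_nat k)))\<^sup>2 / (real (eig_mult A c) * (cmod (eig_pi A c))\<^sup>2))))"
proof -
  interpret digraph G by (rule assms(5))
  interpret strong_digraph G using assms(6,7) by unfold_locales
  have card: "card (eigenvalues (adj_matrix G)) = d + 1" using assms(8) by (simp add: A_def)
  have \<Delta>: "\<Delta> = {(ddist G x y, ddist G y x) | x y. True}" by (simp add: \<Delta>_def)
  show ?thesis
    unfolding A_def Ad_def D_def distance_regular_iff in_partition_iff dist_relation_eq scheme_iff
      bose_mesner_iff distance_algebra_iff two_way_scheme_iff[OF \<Delta>] spectral_iff[OF card]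
      spectral_excess_iff[OF card]
    by simp
qed

end
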